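(* Let $\alpha$ and $\beta$ be two finite Blaschke products of positive degree and let $a,b\in\mathbb{C}$. A linear operator $A$ from $K_\alpha$ into $K_\beta$ belongs to $\mathscr{T}(\alpha,\beta)$ if and only if there are functions $\chi_{a,b}\in K_\alpha$ and $\psi_{a,b}\in K_\beta$ such that $$A-S_{\beta,b}^{*}\,A\,S_{\alpha,a}=\psi_{a,b}\otimes\widetilde{k}_0^{\alpha}+\widetilde{k}_0^{\beta}\otimes\chi_{a,b}.$$
   Context: $H^2$ is the Hardy space of the unit disk $\mathbb{D}$, viewed as a closed subspace of $L^2(\partial\mathbb{D})$ with its usual inner product $\langle\cdot,\cdot\rangle$ (normalized Lebesgue measure, linear in the first argument). For a finite Blaschke product $\alpha$, the model space is $K_\alpha=H^2\ominus\alpha H^2$; its dimension is the degree of $\alpha$ and all its functions are bounded. $P_\alpha$ denotes the orthogonal projection from $L^2(\partial\mathbb{D})$ onto $K_\alpha$. For $\varphi\in L^2(\partial\mathbb{D})$ the asymmetric truncated Toeplitz operator $A_\varphi^{\alpha,\beta}:K_\alpha\to K_\beta$ is $A_\varphi^{\alpha,\beta}f=P_\beta(\varphi f)$, and $\mathscr{T}(\alpha,\beta)$ is the set of all bounded $A_\varphi^{\alpha,\beta}$, $\varphi\in L^2(\partial\mathbb{D})$ (boundedness is automatic here since the spaces are finite-dimensional). The functions $k_0^\alpha(z)=1-\overline{\alpha(0)}\alpha(z)$ and $\widetilde{k}_0^\alpha(z)=\frac{\alpha(z)-\alpha(0)}{z}$ belong to $K_\alpha$. For vectors $f,g$, $f\otimes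 g$ is the operator $(f\otimes g)h=\langle h,g\rangle f$. The compressed shift on $K_\alpha$ is $S_\alpha f=P_\alpha(zf)$, and for $c\in\mathbb{C}$ the modified compressed shift is $S_{\alpha,c}=S_\alpha+c\,(k_0^\alpha\otimes\widetilde{k}_0^\alpha)$. The same notation is used with $\beta$ in place of $\alpha$. *)

theory Defs
  imports "HOL-Analysis.Analysis"
begin

section \<open>The space $L^2$ of the unit circle\<close>

text \<open>Normalized arc length, as a measure whose underlying space is the unit circle.\<close>

definition circle :: "complex measure" where
  "circle = distr (uniform_measure lborel {0..2 * pi}) (restrict_space borel (sphere 0 1)) cis"

definition square_integrable :: "(complex \<Rightarrow> complex) \<Rightarrow> bool" where
  "square_integrable f \<longleftrightarrow>
     f \<in> borel_measurable circle \<and> integrable circle (\<lambda>z. (cmod (f z))\<^sup>2)"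

definition L2_eq :: "(complex \<Rightarrow> complex) \<Rightarrow> (complex \<Rightarrow> complex) \<Rightarrow> bool" where
  "L2_eq f g \<longleftrightarrow> square_integrable f \<and> square_integrable g \<and> (AE z in circle. f z = g z)"

lemma square_integrable_zero: "square_integrable (\<lambda>z. 0)"
  by (simp add: square_integrable_def)

lemma square_integrable_add:
  assumes "square_integrable f" "square_integrable g"
  shows "square_integrable (\<lambda>z. f z + g z)"
proof -
  have meas: "(\<lambda>z. f z + g z) \<in> borel_measurable circle"
    using assms by (intro borel_measurable_add) (simp_all add: square_integrable_def)
  have "integrable circle (\<lambda>z. (cmod (f z + g z))\<^sup>2)"
  proof (rule Bochner_Integration.integrable_bound)
    show "integrable circle (\<lambda>z. 2 * (cmod (f z))\<^sup>2 + 2 * (cmod (g z))\<^sup>2)"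
      using assms by (intro Bochner_Integration.integrable_add integrable_mult_right)
        (simp_all add: square_integrable_def)
    show "(\<lambda>z. (cmod (f z + g z))\<^sup>2) \<in> borel_measurable circle"
      by (intro borel_measurable_power measurable_compose[OF meas borel_measurable_norm])
    have "norm ((cmod (f z + g z))\<^sup>2) \<le> norm (2 * (cmod (f z))\<^sup>2 + 2 * (cmod (g z))\<^sup>2)" for z
    proof -
      have "(cmod (f z + g z))\<^sup>2 \<le> (cmod (f z) + cmod (g z))\<^sup>2"
        by (rule power_mono[OF norm_triangle_ineq norm_ge_zero])
      moreover have "2 * cmod (f z) * cmod (g z) \<le> (cmod (f z))\<^sup>2 + (cmod (g z))\<^sup>2"
        by (rule sum_squares_bound)
      ultimately have "(cmod (f z + g z))\<^sup>2 \<le> 2 * (cmod (f z))\<^sup>2 + 2 * (cmod (g z))\<^sup>2"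
        unfolding power2_sum by linarith
      then show ?thesis
        unfolding real_norm_def abs_of_nonneg[OF zero_le_power2] by (rule order_trans[OF _ abs_ge_self])
    qed
    then show "AE z in circle. norm ((cmod (f z + g z))\<^sup>2) \<le>
        norm (2 * (cmod (f z))\<^sup>2 + 2 * (cmod (g z))\<^sup>2)"
      by (intro AE_I2)
  qed
  with meas show ?thesis by (simp only: square_integrable_def simp_thms)
qed

lemma square_integrable_cmult:
  "square_integrable f \<Longrightarrow> square_integrable (\<lambda>z. c * f z)"
  by (auto simp: square_integrable_def norm_mult power_mult_distrib)

lemma square_integrable_uminus:
  "square_integrable f \<Longrightarrow> square_integrable (\<lambda>z. - f z)"
  by (simp add: square_integrable_def)

lemma borel_measurable_cnj:
  fixes f :: "'a \<Rightarrow> complex"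
  assumes "f \<in> borel_measurable M"
  shows "(\<lambda>z. cnj (f z)) \<in> borel_measurable M"
proof -
  have "continuous_on UNIV cnj" by (rule continuous_on_cnj[OF continuous_on_id])
  from borel_measurable_continuous_on[OF this assms] show ?thesis .
qed

lemma integrable_mult_cnj:
  assumes "square_integrable f" "square_integrable g"
  shows "integrable circle (\<lambda>z. f z * cnj (g z))"
proof (rule Bochner_Integration.integrable_bound)
  show "integrable circle (\<lambda>z. (cmod (f z))\<^sup>2 + (cmod (g z))\<^sup>2)"
    using assms by (auto simp: square_integrable_def)
  show "(\<lambda>z. f z * cnj (g z)) \<in> borel_measurable circle"
    using assms by (intro borel_measurable_times borel_measurable_cnj)
      (auto simp: square_integrable_def)
  have "norm (f z * cnj (g z)) \<le> norm ((cmod (f z))\<^sup>2 + (cmod (g z))\<^sup>2)" for z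
  proof -
    have "0 \<le> cmod (f z) * cmod (g z)" by (intro mult_nonneg_nonneg norm_ge_zero)
    moreover have "2 * (cmod (f z) * cmod (g z)) \<le> (cmod (f z))\<^sup>2 + (cmod (g z))\<^sup>2"
      using sum_squares_bound[of "cmod (f z)" "cmod (g z)"] by (simp only: mult.assoc)
    ultimately have "cmod (f z) * cmod (g z) \<le> (cmod (f z))\<^sup>2 + (cmod (g z))\<^sup>2"
      by linarith
    then show ?thesis
      unfolding norm_mult complex_mod_cnj real_norm_def by (rule order_trans[OF _ abs_ge_self])
  qed
  then show "AE z in circle. norm (f z * cnj (g z)) \<le> norm ((cmod (f z))\<^sup>2 + (cmod (g z))\<^sup>2)"
    by (intro AE_I2)
qed

lemma L2_eq_square_integrable_mult:
  assumes "L2_eq f f'" "L2_eq g g'"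
  shows "square_integrable (\<lambda>z. f z * g z) \<longleftrightarrow> square_integrable (\<lambda>z. f' z * g' z)"
proof -
  have [measurable]: "f \<in> borel_measurable circle" "g \<in> borel_measurable circle"
    "f' \<in> borel_measurable circle" "g' \<in> borel_measurable circle"
    using assms by (auto simp: square_integrable_def L2_eq_def)
  have "AE z in circle. f z = f' z" "AE z in circle. g z = g' z"
    using assms by (auto simp: L2_eq_def)
  then have "AE z in circle. (cmod (f z * g z))\<^sup>2 = (cmod (f' z * g' z))\<^sup>2"
    by eventually_elim simp
  then have "integrable circle (\<lambda>z. (cmod (f z * g z))\<^sup>2) =
      integrable circle (\<lambda>z. (cmod (f' z * g' z))\<^sup>2)"
    by (intro integrable_cong_AE) auto
  then show ?thesis by (simp add: square_integrable_def)
qed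

quotient_type L2 = "complex \<Rightarrow> complex" / partial: L2_eq
proof (rule part_equivpI)
  show "\<exists>f. L2_eq f f"
    by (rule exI[of _ "\<lambda>z. 0"]) (simp add: L2_eq_def square_integrable_zero)
  show "symp L2_eq"
    by (auto simp: symp_def L2_eq_def elim: AE_mp)
  show "transp L2_eq"
    unfolding transp_def L2_eq_def by (auto elim!: eventually_elim2)
qed

instantiation L2 :: real_vector
begin

lift_definition zero_L2 :: L2 is "\<lambda>z. 0"
  by (simp add: L2_eq_def square_integrable_zero)

lift_definition plus_L2 :: "L2 \<Rightarrow> L2 \<Rightarrow> L2" is "\<lambda>f g z. f z + g z"
  by (auto simp: L2_eq_def square_integrable_add elim!: eventually_elim2)

lift_definition uminus_L2 :: "L2 \<Rightarrow> L2" is "\<lambda>f z. - f z"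
  by (auto simp: L2_eq_def square_integrable_uminus elim!: eventually_mono)

definition minus_L2 :: "L2 \<Rightarrow> L2 \<Rightarrow> L2" where
  "minus_L2 f g = f + (- g)"

lift_definition scaleR_L2 :: "real \<Rightarrow> L2 \<Rightarrow> L2" is "\<lambda>r f z. of_real r * f z"
  by (auto simp: L2_eq_def square_integrable_cmult elim!: eventually_mono)

instance
proof
  fix f g h :: L2 and r s :: real
  show "f + g + h = f + (g + h)"
    by transfer (auto simp: L2_eq_def add.assoc intro!: square_integrable_add)
  show "f + g = g + f"
    by transfer (auto simp: L2_eq_def add.commute intro!: square_integrable_add)
  show "0 + f = f"
    by transfer (auto simp: L2_eq_def)
  show "- f + f = 0"
    by transfer (auto simp: L2_eq_def square_integrable_zero)
  show "f - g = f + - g"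
    by (rule minus_L2_def)
  show "r *\<^sub>R (f + g) = r *\<^sub>R f + r *\<^sub>R g"
    by transfer (auto simp: L2_eq_def distrib_left
        intro!: square_integrable_add square_integrable_cmult)
  show "(r + s) *\<^sub>R f = r *\<^sub>R f + s *\<^sub>R f"
    by transfer (auto simp: L2_eq_def distrib_right
        intro!: square_integrable_add square_integrable_cmult)
  show "r *\<^sub>R s *\<^sub>R f = (r * s) *\<^sub>R f"
    by transfer (auto simp: L2_eq_def mult.assoc intro!: square_integrable_cmult)
  show "1 *\<^sub>R f = f"
    by transfer (auto simp: L2_eq_def)
qed

end

lift_definition scaleC :: "complex \<Rightarrow> L2 \<Rightarrow> L2" (infixr "*\<^sub>C" 75) is "\<lambda>c f z. c * f z"
  by (auto simp: L2_eq_def square_integrable_cmult elim!: eventually_mono)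

lift_definition cinner :: "L2 \<Rightarrow> L2 \<Rightarrow> complex" is
  "\<lambda>f g. integral\<^sup>L circle (\<lambda>z. f z * cnj (g z))"
proof -
  fix f f' g g' assume eq: "L2_eq f f'" "L2_eq g g'"
  then have "AE z in circle. f z = f' z" "AE z in circle. g z = g' z"
    by (auto simp: L2_eq_def)
  then have "AE z in circle. f z * cnj (g z) = f' z * cnj (g' z)"
    by eventually_elim simp
  then show "integral\<^sup>L circle (\<lambda>z. f z * cnj (g z)) = integral\<^sup>L circle (\<lambda>z. f' z * cnj (g' z))"
    using eq by (intro integral_cong_AE borel_measurable_integrable integrable_mult_cnj)
      (auto simp: L2_eq_def)
qed

instantiation L2 :: real_inner
begin

definition inner_L2 :: "L2 \<Rightarrow> L2 \<Rightarrow> real" where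
  "inner_L2 f g = Re (cinner f g)"

definition norm_L2 :: "L2 \<Rightarrow> real" where
  "norm_L2 f = sqrt (Re (cinner f f))"

definition sgn_L2 :: "L2 \<Rightarrow> L2" where
  "sgn_L2 f = f /\<^sub>R norm f"

definition dist_L2 :: "L2 \<Rightarrow> L2 \<Rightarrow> real" where
  "dist_L2 f g = norm (f - g)"

definition uniformity_L2 :: "(L2 \<times> L2) filter" where
  "uniformity_L2 = (INF e\<in>{0<..}. principal {(f, g). dist f g < e})"

definition open_L2 :: "L2 set \<Rightarrow> bool" where
  "open_L2 U \<longleftrightarrow> (\<forall>f\<in>U. eventually (\<lambda>(f', g). f' = f \<longrightarrow> g \<in> U) uniformity)"

instance
proof
  fix f g h :: L2 and r :: real and U :: "L2 set"
  show "sgn f = f /\<^sub>R norm f" by (rule sgn_L2_def)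
  show "dist f g = norm (f - g)" by (rule dist_L2_def)
  show "uniformity = (INF e\<in>{0<..}. principal {(x, y::L2). dist x y < e})"
    by (rule uniformity_L2_def)
  show "open U \<longleftrightarrow> (\<forall>x\<in>U. \<forall>\<^sub>F (x', y) in uniformity. x' = x \<longrightarrow> y \<in> U)"
    by (rule open_L2_def)
  show "inner f g = inner g f"
  proof -
    have "cinner g f = cnj (cinner f g)"
    proof transfer
      fix f g
      have "cnj (integral\<^sup>L circle (\<lambda>z. f z * cnj (g z))) =
          integral\<^sup>L circle (\<lambda>z. cnj (f z * cnj (g z)))"
        by (rule Bochner_Integration.integral_cnj[symmetric])
      then show "integral\<^sup>L circle (\<lambda>z. g z * cnj (f z)) =
          cnj (integral\<^sup>L circle (\<lambda>z. f z * cnj (g z)))"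
        by (simp add: mult.commute)
    qed
    then show ?thesis by (simp add: inner_L2_def)
  qed
  show "inner (f + g) h = inner f h + inner g h"
    unfolding inner_L2_def
    by transfer (simp add: L2_eq_def distrib_right integrable_mult_cnj)
  show "inner (r *\<^sub>R f) g = r * inner f g"
    unfolding inner_L2_def by transfer (simp add: mult.assoc)
  have norm_sq: "Re (integral\<^sup>L circle (\<lambda>z. f z * cnj (f z))) = integral\<^sup>L circle (\<lambda>z. (cmod (f z))\<^sup>2)"
    for f :: "complex \<Rightarrow> complex"
  proof -
    have "integral\<^sup>L circle (\<lambda>z. f z * cnj (f z)) =
        integral\<^sup>L circle (\<lambda>z. of_real ((cmod (f z))\<^sup>2))"
      by (intro Bochner_Integration.integral_cong refl) (rule complex_norm_square[symmetric])
    then show ?thesis by (simp only: integral_complex_of_real Re_complex_of_real)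
  qed
  show "0 \<le> inner f f"
    unfolding inner_L2_def by transfer (simp add: norm_sq)
  show "inner f f = 0 \<longleftrightarrow> f = 0"
    unfolding inner_L2_def
  proof transfer
    fix f assume "L2_eq f f"
    then have "square_integrable f" by (simp add: L2_eq_def)
    then show "Re (integral\<^sup>L circle (\<lambda>z. f z * cnj (f z))) = 0 \<longleftrightarrow> L2_eq f (\<lambda>z. 0)"
      unfolding norm_sq
      by (subst integral_nonneg_eq_0_iff_AE)
         (auto simp: L2_eq_def square_integrable_zero square_integrable_def)
  qed
  show "norm f = sqrt (inner f f)"
    by (simp add: norm_L2_def inner_L2_def)
qed

end

definition L2_of :: "(complex \<Rightarrow> complex) \<Rightarrow> L2" where
  "L2_of f = (if square_integrable f then abs_L2 f else 0)"

text \<open>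
  The pointwise product of two classes, when it is again square integrable; the value 0
  otherwise is a convention. For a factor in a model space of a finite Blaschke product, which
  consists of bounded functions, the product is always square integrable.
\<close>

lift_definition L2_mult :: "L2 \<Rightarrow> L2 \<Rightarrow> L2" (infixl "\<odot>" 70) is
  "\<lambda>f g. if square_integrable (\<lambda>z. f z * g z) then (\<lambda>z. f z * g z) else (\<lambda>z. 0)"
proof -
  fix f f' g g' assume eq: "L2_eq f f'" "L2_eq g g'"
  have "AE z in circle. f z = f' z" "AE z in circle. g z = g' z"
    using eq by (auto simp: L2_eq_def)
  then have "AE z in circle. f z * g z = f' z * g' z"
    by eventually_elim simp
  then show "L2_eq
      (if square_integrable (\<lambda>z. f z * g z) then (\<lambda>z. f z * g z) else (\<lambda>z. 0))
      (if square_integrable (\<lambda>z. f' z * g' z) then (\<lambda>z. f' z * g' z) else (\<lambda>z. 0))"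
    using L2_eq_square_integrable_mult[OF eq]
    by (simp add: L2_eq_def square_integrable_zero)
qed

section \<open>Operators on subspaces\<close>

definition clinear_on :: "L2 set \<Rightarrow> L2 set \<Rightarrow> (L2 \<Rightarrow> L2) \<Rightarrow> bool" where
  "clinear_on V W A \<longleftrightarrow>
     (\<forall>f\<in>V. A f \<in> W) \<and>
     (\<forall>f\<in>V. \<forall>g\<in>V. A (f + g) = A f + A g) \<and>
     (\<forall>c. \<forall>f\<in>V. A (c *\<^sub>C f) = c *\<^sub>C A f)"

definition bounded_on :: "L2 set \<Rightarrow> (L2 \<Rightarrow> L2) \<Rightarrow> bool" where
  "bounded_on V A \<longleftrightarrow> (\<exists>C. \<forall>f\<in>V. norm (A f) \<le> C * norm f)"

text \<open>
  Meaningful only where the described vector exists, in particular for every finite-dimensional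
  (more generally, closed) subspace \<open>V\<close>; it is then unique. The same applies to the adjoint
  of an operator mapping \<open>V\<close> to \<open>V\<close>.
\<close>

definition proj :: "L2 set \<Rightarrow> L2 \<Rightarrow> L2" where
  "proj V f = (THE g. g \<in> V \<and> (\<forall>h\<in>V. cinner (f - g) h = 0))"

definition adjoint_on :: "L2 set \<Rightarrow> (L2 \<Rightarrow> L2) \<Rightarrow> L2 \<Rightarrow> L2" where
  "adjoint_on V T g = (THE h. h \<in> V \<and> (\<forall>f\<in>V. cinner (T f) g = cinner f h))"

definition rank_one :: "L2 \<Rightarrow> L2 \<Rightarrow> L2 \<Rightarrow> L2" (infix "\<otimes>" 80) where
  "(f \<otimes> g) h = cinner h g *\<^sub>C f"

section \<open>Hardy space, model spaces and truncated Toeplitz operators\<close>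

text \<open>
  \<open>F\<close> is an element of the Hardy space of the disk: it is holomorphic with bounded
  quadratic integral means. It is identified with its radial boundary function.
\<close>

definition hardy_disk :: "(complex \<Rightarrow> complex) \<Rightarrow> bool" where
  "hardy_disk F \<longleftrightarrow>
     F holomorphic_on ball 0 1 \<and>
     (\<exists>C. \<forall>r\<in>{0..<1::real}. (LINT z|circle. (cmod (F (of_real r * z)))\<^sup>2) \<le> C)"

lift_definition is_hardy :: "L2 \<Rightarrow> bool" is
  "\<lambda>f. \<exists>F. hardy_disk F \<and>
     (AE z in circle. ((\<lambda>r::real. F (of_real r * z)) \<longlongrightarrow> f z) (at_left 1))"
proof -
  have "\<exists>F. hardy_disk F \<and>
      (AE z in circle. ((\<lambda>r::real. F (of_real r * z)) \<longlongrightarrow> g z) (at_left 1))"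
    if "L2_eq f g" "\<exists>F. hardy_disk F \<and>
      (AE z in circle. ((\<lambda>r::real. F (of_real r * z)) \<longlongrightarrow> f z) (at_left 1))" for f g
  proof -
    from that(2) obtain F where F: "hardy_disk F"
      "AE z in circle. ((\<lambda>r::real. F (of_real r * z)) \<longlongrightarrow> f z) (at_left 1)" by blast
    have "AE z in circle. f z = g z" using that(1) by (simp add: L2_eq_def)
    with F(2) have "AE z in circle. ((\<lambda>r::real. F (of_real r * z)) \<longlongrightarrow> g z) (at_left 1)"
      by eventually_elim simp
    with F(1) show ?thesis by blast
  qed
  moreover have "L2_eq g f" if "L2_eq f g" for f g
    using that by (auto simp: L2_eq_def elim: AE_mp)
  ultimately show "L2_eq f g \<Longrightarrow>
     (\<exists>F. hardy_disk F \<and>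
       (AE z in circle. ((\<lambda>r::real. F (of_real r * z)) \<longlongrightarrow> f z) (at_left 1))) =
     (\<exists>F. hardy_disk F \<and>
       (AE z in circle. ((\<lambda>r::real. F (of_real r * z)) \<longlongrightarrow> g z) (at_left 1)))" for f g
    by blast
qed

definition H2 :: "L2 set" where
  "H2 = {f. is_hardy f}"

text \<open>Only the values on the closed disk matter.\<close>

definition finite_blaschke :: "nat \<Rightarrow> (complex \<Rightarrow> complex) \<Rightarrow> bool" where
  "finite_blaschke n \<alpha> \<longleftrightarrow>
     (\<exists>c w. cmod c = 1 \<and> (\<forall>i<n. cmod (w i) < 1) \<and>
        (\<forall>z\<in>cball 0 1. \<alpha> z = c * (\<Prod>i<n. (z - w i) / (1 - cnj (w i) * z))))"

definition model_space :: "(complex \<Rightarrow> complex) \<Rightarrow> L2 set" where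
  "model_space \<alpha> = {f \<in> H2. \<forall>h\<in>H2. cinner f (L2_of \<alpha> \<odot> h) = 0}"

definition atto :: "(complex \<Rightarrow> complex) \<Rightarrow> (complex \<Rightarrow> complex) \<Rightarrow> L2 \<Rightarrow> L2 \<Rightarrow> L2" where
  "atto \<alpha> \<beta> \<phi> f = proj (model_space \<beta>) (\<phi> \<odot> f)"

text \<open>
  Operators on the model space of \<open>\<alpha>\<close> are represented by functions on the whole type;
  only their values on the model space are relevant.
\<close>

definition attos :: "(complex \<Rightarrow> complex) \<Rightarrow> (complex \<Rightarrow> complex) \<Rightarrow> (L2 \<Rightarrow> L2) set" where
  "attos \<alpha> \<beta> =
     {A. bounded_on (model_space \<alpha>) A \<and> (\<exists>\<phi>. \<forall>f\<in>model_space \<alpha>. A f = atto \<alpha> \<beta> \<phi> f)}"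

definition k0 :: "(complex \<Rightarrow> complex) \<Rightarrow> L2" where
  "k0 \<alpha> = L2_of (\<lambda>z. 1 - cnj (\<alpha> 0) * \<alpha> z)"

definition k0_tilde :: "(complex \<Rightarrow> complex) \<Rightarrow> L2" where
  "k0_tilde \<alpha> = L2_of (\<lambda>z. (\<alpha> z - \<alpha> 0) / z)"

definition compressed_shift :: "(complex \<Rightarrow> complex) \<Rightarrow> L2 \<Rightarrow> L2" where
  "compressed_shift \<alpha> f = proj (model_space \<alpha>) (L2_of (\<lambda>z. z) \<odot> f)"

definition mod_shift :: "(complex \<Rightarrow> complex) \<Rightarrow> complex \<Rightarrow> L2 \<Rightarrow> L2" where
  "mod_shift \<alpha> c f = compressed_shift \<alpha> f + c *\<^sub>C (k0 \<alpha> \<otimes> k0_tilde \<alpha>) f"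

end

theory Submission
  imports Defs "HOL-Complex_Analysis.Cauchy_Integral_Formula"
begin

text \<open>
  Multiplication by \<open>z\<close> on the circle is unitary, so \<open>\<langle>\<phi> f, g\<rangle> = \<langle>\<phi> z f, z g\<rangle>\<close> for every symbol
  \<open>\<phi>\<close>. For \<open>f\<close> in the model space of \<open>\<alpha>\<close> the product \<open>z f\<close> leaves that space only by the multiple
  \<open>\<langle>f, k0_tilde \<alpha>\<rangle> \<alpha>\<close> (lemma \<open>compressed_shift_decomposition\<close>), and likewise for \<open>g\<close> and \<open>\<beta>\<close>.
  Expanding, the form of a truncated Toeplitz operator changes under the pair of compressed shifts
  only by terms that contain \<open>\<langle>f, k0_tilde \<alpha>\<rangle>\<close> or \<open>\<langle>k0_tilde \<beta>, g\<rangle>\<close>: this is the displacement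
  equation for \<open>a = b = 0\<close> (\<open>rank_two_displacement_atto\<close>).

  Conversely, given \<open>psi\<close> and \<open>chi\<close>, the operator with the bounded symbol
  \<open>z (cnj \<alpha>) psi + (cnj z) \<beta> (cnj chi)\<close> has the prescribed displacement
  (\<open>atto_with_displacement\<close>). Its difference \<open>D\<close> from \<open>A\<close> has displacement zero, that is
  \<open>\<langle>D f, g\<rangle> = \<langle>D S\<^sup>k f, T\<^sup>k g\<rangle>\<close> for all \<open>k\<close>, where \<open>S\<close> and \<open>T\<close> are the compressed shifts. As \<open>S\<close> is
  a contraction and \<open>T\<^sup>k g\<close> is the compression of \<open>z\<^sup>k g\<close>, which tends weakly to zero, \<open>D = 0\<close>
  (\<open>displacement_zero_imp_zero\<close>). General \<open>a\<close> and \<open>b\<close> reduce to \<open>a = b = 0\<close>, because the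
  rank-one perturbations of the shifts can be absorbed into \<open>psi\<close> and \<open>chi\<close>
  (\<open>rank_two_displacement_perturb\<close>).

  All of this rests on a concrete description of the model space (\<open>fin_dim_model_space\<close> and
  \<open>model_space_eq_pairs\<close>): it has finite dimension, and it consists of the boundary functions \<open>f\<close>
  of the disk algebra for which \<open>(cnj z) \<alpha> (cnj f)\<close> is again such a boundary function. The link
  with \<open>H\<^sup>2\<close>, which is given by radial limits, is that Cauchy's formula survives the passage to the
  boundary (\<open>hardy_pairing_tendsto\<close>).
\<close>

section \<open>Integration over the unit circle\<close>

lemma sphere_mult_cnj: "z \<in> sphere 0 1 \<Longrightarrow> z * cnj z = (1::complex)"
  by (simp add: complex_norm_square[symmetric])

lemma space_circle: "space circle = sphere 0 1"
  by (simp add: circle_def)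

lemma sets_circle: "sets circle = sets (restrict_space borel (sphere 0 1))"
  by (simp add: circle_def)

lemma cis_measurable:
  "cis \<in> measurable (uniform_measure lborel {0..2 * pi}) (restrict_space borel (sphere 0 1))"
proof (rule measurable_restrict_space2)
  have "cis \<in> borel_measurable borel"
    by (intro borel_measurable_continuous_onI continuous_intros)
  then show "cis \<in> borel_measurable (uniform_measure lborel {0..2 * pi})"
    by (simp add: measurable_cong_sets[OF sets_uniform_measure refl])
qed auto

lemma measure_circle: "finite_measure circle" "emeasure circle (space circle) = 1"
proof -
  have "emeasure circle (space circle) = emeasure (uniform_measure lborel {0..2 * pi}) (cis -` sphere 0 1)"
    unfolding circle_def by (subst emeasure_distr[OF cis_measurable])
      (auto simp: sets_restrict_space space_restrict_space vimage_def intro!: image_eqI[where x = UNIV])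
  also have "cis -` sphere 0 1 = UNIV"
    by auto
  also have "emeasure (uniform_measure lborel {0..2 * pi}) \<dots> = 1"
    using pi_gt_zero by (simp add: ennreal_divide_self)
  finally show *: "emeasure circle (space circle) = 1" .
  show "finite_measure circle"
    by (rule finite_measureI) (simp add: *)
qed

interpretation circle: finite_measure circle
  by (rule measure_circle)

lemma continuous_measurable_circle:
  fixes f :: "complex \<Rightarrow> 'b::topological_space"
  shows "continuous_on (sphere 0 1) f \<Longrightarrow> f \<in> borel_measurable circle"
  using borel_measurable_continuous_on_restrict[of "sphere 0 1" f]
  by (simp add: measurable_cong_sets[OF sets_circle refl])

lemma continuous_circle_bound:
  fixes f :: "complex \<Rightarrow> complex"
  assumes "continuous_on (sphere 0 1) f"
  shows "\<exists>B. \<forall>z\<in>sphere 0 1. cmod (f z) \<le> B"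
proof -
  have "bounded (f ` sphere 0 1)"
    using assms by (intro compact_imp_bounded compact_continuous_image) auto
  then show ?thesis by (auto simp: bounded_iff)
qed

lemma integral_circle:
  fixes f :: "complex \<Rightarrow> complex"
  assumes "continuous_on (sphere 0 1) f"
  shows "((\<lambda>t. f (cis t)) has_integral (2 * pi * integral\<^sup>L circle f)) {0..2 * pi}"
proof -
  have cont: "continuous_on {0..2 * pi} (\<lambda>t. f (cis t))"
    by (rule continuous_on_compose2[OF assms]) (auto intro!: continuous_intros)
  have int: "set_integrable lborel {0..2 * pi} (\<lambda>t. f (cis t))"
    by (rule borel_integrable_atLeastAtMost') (rule cont)
  have bm: "(\<lambda>t. f (cis t)) \<in> borel_measurable (uniform_measure lborel {0..2 * pi})"
    using measurable_compose[OF cis_measurable, of f borel] continuous_measurable_circle[OF assms]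
    by (simp add: measurable_cong_sets[OF sets_circle refl])
  then have bm': "(\<lambda>t. f (cis t)) \<in> borel_measurable lborel"
    by (simp add: measurable_cong_sets[OF sets_uniform_measure refl])
  have "integral\<^sup>L circle f = (LINT t|uniform_measure lborel {0..2 * pi}. f (cis t))"
    unfolding circle_def
    by (rule integral_distr[OF cis_measurable]) 
       (use continuous_measurable_circle[OF assms] in \<open>simp add: measurable_cong_sets[OF sets_circle refl]\<close>)
  also have "uniform_measure lborel {0..2 * pi} =
      density lborel (\<lambda>t. ennreal (indicator {0..2 * pi} t / (2 * pi)))"
    unfolding uniform_measure_def
    by (intro density_cong)
       (auto intro!: AE_I2 simp: divide_ennreal[symmetric] split: split_indicator simp flip: ennreal_1)
  also have "(LINT t|\<dots>. f (cis t)) =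
      (LINT t|lborel. (indicator {0..2 * pi} t / (2 * pi)) *\<^sub>R f (cis t))"
    by (rule integral_density[OF bm']) (auto intro!: AE_I2)
  also have "\<dots> = (LINT t|lborel. (1 / (2 * pi)) *\<^sub>R (indicator {0..2 * pi} t *\<^sub>R f (cis t)))"
    by simp
  also have "\<dots> = (1 / (2 * pi)) *\<^sub>R (LBINT t:{0..2 * pi}. f (cis t))"
    unfolding set_lebesgue_integral_def by (rule integral_scaleR_right)
  also have "(LBINT t:{0..2 * pi}. f (cis t)) = integral {0..2 * pi} (\<lambda>t. f (cis t))"
    by (rule set_borel_integral_eq_integral(2)[OF int])
  finally have "2 * pi * integral\<^sup>L circle f = integral {0..2 * pi} (\<lambda>t. f (cis t))"
    by (simp add: scaleR_conv_of_real)
  with integrable_integral[OF integrable_continuous_real[OF cont]] show ?thesis by simp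
qed

section \<open>The disk algebra\<close>

text \<open>The model space of a finite Blaschke product lies in this algebra, so its members are bounded
  and have honest values on the circle.\<close>

definition disk_algebra :: "(complex \<Rightarrow> complex) set" where
  "disk_algebra = {G. continuous_on (cball 0 1) G \<and> G holomorphic_on ball 0 1}"

lemma disk_algebra_intros:
  "(\<lambda>z. z) \<in> disk_algebra"
  "(\<lambda>z. c) \<in> disk_algebra"
  "\<lbrakk>F \<in> disk_algebra; G \<in> disk_algebra\<rbrakk> \<Longrightarrow> (\<lambda>z. F z + G z) \<in> disk_algebra"
  "\<lbrakk>F \<in> disk_algebra; G \<in> disk_algebra\<rbrakk> \<Longrightarrow> (\<lambda>z. F z - G z) \<in> disk_algebra"
  "\<lbrakk>F \<in> disk_algebra; G \<in> disk_algebra\<rbrakk> \<Longrightarrow> (\<lambda>z. F z * G z) \<in> disk_algebra"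
  "F \<in> disk_algebra \<Longrightarrow> (\<lambda>z. F z ^ k) \<in> disk_algebra"
  "\<lbrakk>F \<in> disk_algebra; G \<in> disk_algebra; \<And>z. z \<in> cball 0 1 \<Longrightarrow> G z \<noteq> 0\<rbrakk>
    \<Longrightarrow> (\<lambda>z. F z / G z) \<in> disk_algebra"
  "\<lbrakk>\<And>i. i \<in> I \<Longrightarrow> E i \<in> disk_algebra\<rbrakk> \<Longrightarrow> (\<lambda>z. \<Sum>i\<in>I. E i z) \<in> disk_algebra"
  "\<lbrakk>\<And>i. i \<in> I \<Longrightarrow> E i \<in> disk_algebra\<rbrakk> \<Longrightarrow> (\<lambda>z. \<Prod>i\<in>I. E i z) \<in> disk_algebra"
  by (auto simp: disk_algebra_def intro!: continuous_intros holomorphic_intros)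

lemma disk_algebra_cong:
  assumes "\<And>z. z \<in> cball 0 1 \<Longrightarrow> F z = G z" "G \<in> disk_algebra"
  shows "F \<in> disk_algebra"
proof -
  have "continuous_on (cball 0 1) F"
    using assms by (subst continuous_on_cong[OF refl, of _ F G]) (auto simp: disk_algebra_def)
  moreover have "F holomorphic_on ball 0 1"
    using assms by (subst holomorphic_cong[OF refl, of _ F G]) (auto simp: disk_algebra_def)
  ultimately show ?thesis by (simp add: disk_algebra_def)
qed

lemma disk_algebra_continuous_circle:
  "G \<in> disk_algebra \<Longrightarrow> continuous_on (sphere 0 1) G"
  by (auto simp: disk_algebra_def elim: continuous_on_subset)

text \<open>Cauchy's formula for the \<open>k\<close>-th derivative at 0, read on the circle, where
  \<open>dz = i z dt\<close> and \<open>1 / z = cnj z\<close>.\<close>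

lemma circle_coefficient:
  assumes "G \<in> disk_algebra"
  shows "(LINT z|circle. G z * cnj z ^ k) = (deriv ^^ k) G 0 / fact k"
proof -
  have "((\<lambda>u. G u / (u - 0) ^ Suc k) has_contour_integral
      (2 * pi * \<i>) / fact k * (deriv ^^ k) G 0) (circlepath 0 1)"
    using assms by (intro Cauchy_has_contour_integral_higher_derivative_circlepath)
      (auto simp: disk_algebra_def)
  then have "((\<lambda>t. G (cis t) / cis t ^ Suc k * \<i> * cis t) has_integral
      (2 * pi * \<i>) / fact k * (deriv ^^ k) G 0) {0..2 * pi}"
    by (simp add: circlepath_def has_contour_integral_part_circlepath_iff)
  moreover have "G (cis t) / cis t ^ Suc k * \<i> * cis t = \<i> * (G (cis t) * cnj (cis t) ^ k)" for t
    by (simp add: field_simps power_divide cis_cnj flip: cis_inverse)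
  ultimately have 1: "((\<lambda>t. \<i> * (G (cis t) * cnj (cis t) ^ k)) has_integral
      (2 * pi * \<i>) / fact k * (deriv ^^ k) G 0) {0..2 * pi}"
    by simp
  have "continuous_on (sphere 0 1) (\<lambda>z. G z * cnj z ^ k)"
    by (intro continuous_intros disk_algebra_continuous_circle assms)
  from has_integral_mult_right[OF integral_circle[OF this], of \<i>]
  have 2: "((\<lambda>t. \<i> * (G (cis t) * cnj (cis t) ^ k)) has_integral
      \<i> * (2 * pi * (LINT z|circle. G z * cnj z ^ k))) {0..2 * pi}" .
  from has_integral_unique[OF 1 2] show ?thesis
    by (simp add: field_simps)
qed

lemma circle_mean:
  "G \<in> disk_algebra \<Longrightarrow> (LINT z|circle. G z) = G 0"
  using circle_coefficient[of G 0] by simp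

lemma circle_mean_shift:
  assumes "G \<in> disk_algebra"
  shows "(LINT z|circle. z * G z) = 0"
  using circle_mean[of "\<lambda>z. z * G z"] assms by (simp add: disk_algebra_intros)

text \<open>The difference quotient at 0 has a removable singularity there. This splits off constant terms,
  which is where the rank-one defects of the shifts come from.\<close>

lemma disk_algebra_divide_z:
  assumes "G \<in> disk_algebra"
  obtains H where "H \<in> disk_algebra" "\<And>z. G z = G 0 + z * H z"
proof -
  define H where "H = (\<lambda>z. if z = 0 then deriv G 0 else (G z - G 0) / (z - 0))"
  have hol: "H holomorphic_on ball 0 1"
    unfolding H_def using assms by (intro pole_lemma_open) (auto simp: disk_algebra_def)
  have "continuous (at z within cball 0 1) H" if z: "z \<in> cball 0 1" for z
  proof (cases "z = 0")
    case True
    have "continuous_on (ball 0 1) H"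
      using hol by (rule holomorphic_on_imp_continuous_on)
    then have "isCont H z"
      using True by (simp add: continuous_on_eq_continuous_at)
    then show ?thesis by (rule continuous_at_imp_continuous_at_within)
  next
    case False
    have cG: "continuous (at z within cball 0 1) G"
      using assms z by (simp add: disk_algebra_def continuous_on_eq_continuous_within)
    show ?thesis
    proof (rule continuous_transform_within)
      show "continuous (at z within cball 0 1) (\<lambda>w. (G w - G 0) / w)"
        using cG False by (intro continuous_intros) auto
      show "0 < cmod z" using False by simp
      show "(G w - G 0) / w = H w" if "w \<in> cball 0 1" "dist w z < cmod z" for w
        using that by (auto simp: H_def dist_norm)
    qed (rule z)
  qed
  then have "H \<in> disk_algebra"
    using hol by (simp add: disk_algebra_def continuous_on_eq_continuous_within)
  moreover have "G z = G 0 + z * H z" for z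
    by (simp add: H_def)
  ultimately show thesis by (rule that)
qed

section \<open>Calculating with classes of functions\<close>

lemma L2_eq_refl_iff: "L2_eq f f \<longleftrightarrow> square_integrable f"
  by (auto simp: L2_eq_def)

lemma L2_representative:
  obtains f where "square_integrable f" "F = L2_of f"
proof
  show sq: "square_integrable (rep_L2 F)"
    using Quotient3_rep_reflp[OF Quotient3_L2, of F] by (simp add: L2_eq_def)
  then show "F = L2_of (rep_L2 F)"
    using Quotient3_abs_rep[OF Quotient3_L2, of F] by (simp add: L2_of_def)
qed

lemma L2_of_add:
  assumes "square_integrable f" "square_integrable g"
  shows "L2_of f + L2_of g = L2_of (\<lambda>z. f z + g z)"
  using assms by (simp add: L2_of_def square_integrable_add plus_L2.abs_eq L2_eq_refl_iff)

lemma L2_of_scaleC: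
  assumes "square_integrable f"
  shows "c *\<^sub>C L2_of f = L2_of (\<lambda>z. c * f z)"
  using assms by (simp add: L2_of_def square_integrable_cmult scaleC.abs_eq L2_eq_refl_iff)

lemma cinner_L2_of:
  assumes "square_integrable f" "square_integrable g"
  shows "cinner (L2_of f) (L2_of g) = (LINT z|circle. f z * cnj (g z))"
  using assms by (simp add: L2_of_def cinner.abs_eq L2_eq_refl_iff)

lemma L2_mult_L2_of:
  assumes "square_integrable f" "square_integrable g" "square_integrable (\<lambda>z. f z * g z)"
  shows "L2_of f \<odot> L2_of g = L2_of (\<lambda>z. f z * g z)"
  using assms by (simp add: L2_of_def L2_mult.abs_eq L2_eq_refl_iff)

lemma L2_of_eqI:
  assumes "square_integrable f" "square_integrable g" "AE z in circle. f z = g z"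
  shows "L2_of f = L2_of g"
  using assms Quotient3_rel_abs[OF Quotient3_L2, of f g] by (simp add: L2_of_def L2_eq_def)

lemma square_integrable_cong:
  assumes "\<And>z. z \<in> sphere 0 1 \<Longrightarrow> f z = g z"
  shows "square_integrable f \<longleftrightarrow> square_integrable g"
proof -
  have "f \<in> borel_measurable circle \<longleftrightarrow> g \<in> borel_measurable circle"
    by (intro measurable_cong) (simp add: assms space_circle)
  moreover have "integrable circle (\<lambda>z. (cmod (f z))\<^sup>2) \<longleftrightarrow> integrable circle (\<lambda>z. (cmod (g z))\<^sup>2)"
    by (intro Bochner_Integration.integrable_cong) (simp_all add: assms space_circle)
  ultimately show ?thesis by (simp add: square_integrable_def)
qed

lemma L2_of_cong:
  assumes "\<And>z. z \<in> sphere 0 1 \<Longrightarrow> f z = g z"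
  shows "L2_of f = L2_of g"
proof (cases "square_integrable f")
  case True
  then show ?thesis
    using square_integrable_cong[of f g, OF assms]
    by (intro L2_of_eqI) (auto simp: space_circle assms intro!: AE_I2)
next
  case False
  then show ?thesis
    using square_integrable_cong[of f g, OF assms] by (simp add: L2_of_def)
qed

lemma L2_mult_commute: "F \<odot> G = G \<odot> F"
proof -
  obtain f g where "square_integrable f" "F = L2_of f" "square_integrable g" "G = L2_of g"
    by (metis L2_representative)
  then show ?thesis
    by (simp add: L2_of_def L2_mult.abs_eq L2_eq_refl_iff mult.commute)
qed

lemma H2_iff:
  assumes "square_integrable f"
  shows "L2_of f \<in> H2 \<longleftrightarrow> (\<exists>F. hardy_disk F \<and>
     (AE z in circle. ((\<lambda>r::real. F (of_real r * z)) \<longlongrightarrow> f z) (at_left 1)))"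
  using assms by (simp add: H2_def L2_of_def is_hardy.abs_eq L2_eq_refl_iff)

interpretation L2: vector_space scaleC
proof
  fix c d :: complex and F G :: L2
  obtain f g where fg: "square_integrable f" "F = L2_of f" "square_integrable g" "G = L2_of g"
    by (metis L2_representative)
  show "c *\<^sub>C (F + G) = c *\<^sub>C F + c *\<^sub>C G" "(c + d) *\<^sub>C F = c *\<^sub>C F + d *\<^sub>C F"
    "c *\<^sub>C d *\<^sub>C F = (c * d) *\<^sub>C F" "1 *\<^sub>C F = F"
    using fg by (simp_all add: L2_of_add L2_of_scaleC square_integrable_add square_integrable_cmult
        algebra_simps)
qed

lemma cinner_add_left: "cinner (F + G) H = cinner F H + cinner G H"
proof -
  obtain f g h where *: "square_integrable f" "F = L2_of f" "square_integrable g" "G = L2_of g"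
    "square_integrable h" "H = L2_of h"
    by (metis L2_representative)
  then show ?thesis
    by (simp add: L2_of_add cinner_L2_of square_integrable_add distrib_right integrable_mult_cnj)
qed

lemma cinner_scaleC_left: "cinner (c *\<^sub>C F) H = c * cinner F H"
proof -
  obtain f h where "square_integrable f" "F = L2_of f" "square_integrable h" "H = L2_of h"
    by (metis L2_representative)
  then show ?thesis
    by (simp add: L2_of_scaleC cinner_L2_of square_integrable_cmult mult.assoc)
qed

lemma cinner_commute: "cinner G F = cnj (cinner F G)"
proof -
  obtain f g where "square_integrable f" "F = L2_of f" "square_integrable g" "G = L2_of g"
    by (metis L2_representative)
  then show ?thesis
    by (simp add: cinner_L2_of mult.commute flip: Bochner_Integration.integral_cnj)
qed

lemma cinner_self: "cinner F F = of_real ((norm F)\<^sup>2)"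
proof -
  have "Im (cinner F F) = 0"
    using arg_cong[OF cinner_commute[of F F], of Im] by simp
  moreover have "Re (cinner F F) = (norm F)\<^sup>2"
    by (simp add: power2_norm_eq_inner inner_L2_def)
  ultimately show ?thesis by (simp add: complex_eq_iff)
qed

lemma cinner_eq_zero_iff: "cinner F F = 0 \<longleftrightarrow> F = 0"
  by (simp add: cinner_self)

lemma scaleC_minus_one: "- F = (-1) *\<^sub>C F"
  using L2.scale_minus_left[of 1 F] by simp

lemma cinner_add_right: "cinner H (F + G) = cinner H F + cinner H G"
  by (simp only: cinner_commute[of H] cinner_add_left complex_cnj_add)

lemma cinner_scaleC_right: "cinner H (c *\<^sub>C F) = cnj c * cinner H F"
  by (simp only: cinner_commute[of H] cinner_scaleC_left complex_cnj_mult)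

lemma cinner_minus_left: "cinner (- F) H = - cinner F H"
  unfolding scaleC_minus_one cinner_scaleC_left by simp

lemma cinner_minus_right: "cinner H (- F) = - cinner H F"
  unfolding scaleC_minus_one cinner_scaleC_right by simp

lemma cinner_diff_left: "cinner (F - G) H = cinner F H - cinner G H"
  unfolding minus_L2_def cinner_add_left cinner_minus_left by simp

lemma cinner_diff_right: "cinner H (F - G) = cinner H F - cinner H G"
  unfolding minus_L2_def cinner_add_right cinner_minus_right by simp

lemma cinner_zero [simp]: "cinner 0 F = 0" "cinner F 0 = 0"
  using cinner_scaleC_left[of 0 0 F] cinner_scaleC_right[of F 0 0] by simp_all

lemma cinner_sum_left: "cinner (sum F I) H = (\<Sum>i\<in>I. cinner (F i) H)"
  by (induction I rule: infinite_finite_induct) (simp_all add: cinner_add_left)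

lemma cinner_sum_right: "cinner H (sum F I) = (\<Sum>i\<in>I. cinner H (F i))"
  by (induction I rule: infinite_finite_induct) (simp_all add: cinner_add_right)

lemmas cinner_simps = cinner_add_left cinner_add_right cinner_diff_left cinner_diff_right
  cinner_scaleC_left cinner_scaleC_right cinner_sum_left cinner_sum_right

lemma norm_scaleC: "norm (c *\<^sub>C F) = cmod c * norm F"
proof -
  have "cinner (c *\<^sub>C F) (c *\<^sub>C F) = (c * cnj c) * cinner F F"
    by (simp add: cinner_scaleC_left cinner_scaleC_right)
  then have "complex_of_real ((norm (c *\<^sub>C F))\<^sup>2) = of_real ((cmod c * norm F)\<^sup>2)"
    unfolding cinner_self complex_norm_square[symmetric] by (simp add: power_mult_distrib)
  then show ?thesis
    by (simp only: of_real_eq_iff) (simp add: power2_eq_iff_nonneg)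
qed

lemma norm_cinner_le: "cmod (cinner F G) \<le> norm F * norm G"
proof (cases "cinner F G = 0")
  case False
  define c where "c = cnj (cinner F G) / cmod (cinner F G)"
  have c: "cmod c = 1" using False by (simp add: c_def norm_divide)
  have "c * cinner F G = cmod (cinner F G)"
    using False by (simp add: c_def field_simps complex_norm_square[symmetric] power2_eq_square[symmetric])
  then have "cmod (cinner F G) = inner (c *\<^sub>C F) G"
    by (simp add: inner_L2_def cinner_scaleC_left)
  also have "\<dots> \<le> norm (c *\<^sub>C F) * norm G"
    by (rule norm_cauchy_schwarz)
  also have "norm (c *\<^sub>C F) = norm F"
    using c by (simp add: norm_scaleC)
  finally show ?thesis .
qed simp

subsection \<open>Bounded functions\<close>

definition circle_bounded :: "(complex \<Rightarrow> complex) set" where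
  "circle_bounded = {g \<in> borel_measurable circle. \<exists>B. \<forall>z\<in>sphere 0 1. cmod (g z) \<le> B}"

lemma circle_boundedE:
  assumes "g \<in> circle_bounded"
  obtains B where "B \<ge> 0" "\<forall>z\<in>sphere 0 1. cmod (g z) \<le> B"
proof -
  obtain B where B: "\<forall>z\<in>sphere 0 1. cmod (g z) \<le> B"
    using assms by (auto simp: circle_bounded_def)
  have "cmod (g 1) \<le> B" using B by auto
  then have "B \<ge> 0" using norm_ge_zero[of "g 1"] by linarith
  with B that show thesis by blast
qed

lemma continuous_circle_bounded: "continuous_on (sphere 0 1) g \<Longrightarrow> g \<in> circle_bounded"
  by (simp add: circle_bounded_def continuous_measurable_circle continuous_circle_bound)

lemma disk_algebra_circle_bounded: "g \<in> disk_algebra \<Longrightarrow> g \<in> circle_bounded"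
  by (simp add: continuous_circle_bounded disk_algebra_continuous_circle)

lemma circle_bounded_mult:
  assumes "f \<in> circle_bounded" "g \<in> circle_bounded"
  shows "(\<lambda>z. f z * g z) \<in> circle_bounded"
proof -
  obtain B where "B \<ge> 0" "\<forall>z\<in>sphere 0 1. cmod (f z) \<le> B"
    using assms(1) by (rule circle_boundedE)
  moreover obtain C where "C \<ge> 0" "\<forall>z\<in>sphere 0 1. cmod (g z) \<le> C"
    using assms(2) by (rule circle_boundedE)
  ultimately have "\<forall>z\<in>sphere 0 1. cmod (f z * g z) \<le> B * C"
    by (auto simp: norm_mult intro!: mult_mono)
  with assms show ?thesis by (auto simp: circle_bounded_def)
qed

lemma circle_bounded_add:
  assumes "f \<in> circle_bounded" "g \<in> circle_bounded"
  shows "(\<lambda>z. f z + g z) \<in> circle_bounded"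
proof -
  obtain B where "B \<ge> 0" "\<forall>z\<in>sphere 0 1. cmod (f z) \<le> B"
    using assms(1) by (rule circle_boundedE)
  moreover obtain C where "C \<ge> 0" "\<forall>z\<in>sphere 0 1. cmod (g z) \<le> C"
    using assms(2) by (rule circle_boundedE)
  ultimately have "\<forall>z\<in>sphere 0 1. cmod (f z + g z) \<le> B + C"
    by (auto intro!: norm_triangle_le add_mono)
  with assms show ?thesis by (auto simp: circle_bounded_def)
qed

lemma circle_bounded_cnj: "g \<in> circle_bounded \<Longrightarrow> (\<lambda>z. cnj (g z)) \<in> circle_bounded"
  by (auto simp: circle_bounded_def intro: borel_measurable_cnj)

lemma circle_bounded_power: "(\<lambda>z. z ^ k) \<in> circle_bounded"
  by (intro continuous_circle_bounded continuous_intros)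

lemma circle_bounded_const_id: "(\<lambda>z. c) \<in> circle_bounded" "(\<lambda>z. z) \<in> circle_bounded"
  by (intro continuous_circle_bounded continuous_intros)+

lemma square_integrable_mult_bounded:
  assumes "g \<in> circle_bounded" "square_integrable h"
  shows "square_integrable (\<lambda>z. g z * h z)" "square_integrable (\<lambda>z. h z * g z)"
proof -
  obtain B where B: "B \<ge> 0" "\<forall>z\<in>sphere 0 1. cmod (g z) \<le> B"
    using assms(1) by (rule circle_boundedE)
  have "integrable circle (\<lambda>z. (cmod (g z * h z))\<^sup>2)"
  proof (rule Bochner_Integration.integrable_bound)
    show "integrable circle (\<lambda>z. B\<^sup>2 * (cmod (h z))\<^sup>2)"
      using assms by (simp add: square_integrable_def)
    show "(\<lambda>z. (cmod (g z * h z))\<^sup>2) \<in> borel_measurable circle"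
      using assms by (auto simp: square_integrable_def circle_bounded_def)
    show "AE z in circle. norm ((cmod (g z * h z))\<^sup>2) \<le> norm (B\<^sup>2 * (cmod (h z))\<^sup>2)"
    proof (rule AE_I2)
      fix z assume "z \<in> space circle"
      with B have "cmod (g z) \<le> B" by (simp add: space_circle)
      then have "(cmod (g z))\<^sup>2 \<le> B\<^sup>2" by (simp add: power_mono)
      then show "norm ((cmod (g z * h z))\<^sup>2) \<le> norm (B\<^sup>2 * (cmod (h z))\<^sup>2)"
        by (simp add: norm_mult power_mult_distrib mult_right_mono)
    qed
  qed
  then show "square_integrable (\<lambda>z. g z * h z)"
    using assms by (auto simp: square_integrable_def circle_bounded_def)
  then show "square_integrable (\<lambda>z. h z * g z)"
    by (simp add: mult.commute)
qed

lemma square_integrable_bounded: "g \<in> circle_bounded \<Longrightarrow> square_integrable g"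
  using square_integrable_mult_bounded(1)[of g "\<lambda>z. 1"]
  by (simp add: square_integrable_def)

lemma integrable_bounded: "g \<in> circle_bounded \<Longrightarrow> integrable circle g"
  using integrable_mult_cnj[of g "\<lambda>z. 1"]
  by (simp add: square_integrable_bounded circle_bounded_const_id)

lemma cinner_bounded:
  assumes "f \<in> circle_bounded" "g \<in> circle_bounded"
  shows "cinner (L2_of f) (L2_of g) = (LINT z|circle. f z * cnj (g z))"
  using assms by (simp add: cinner_L2_of square_integrable_bounded)

lemma L2_mult_bounded:
  assumes "f \<in> circle_bounded" "g \<in> circle_bounded"
  shows "L2_of f \<odot> L2_of g = L2_of (\<lambda>z. f z * g z)"
  using assms by (simp add: L2_mult_L2_of square_integrable_bounded circle_bounded_mult)

text \<open>A bounded factor can be moved to the other side of the inner product. Thus a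
  form \<open>\<langle>\<phi> f, g\<rangle>\<close> depends on the symbol only through its inner products with bounded functions.\<close>

lemma cinner_mult_bounded:
  assumes "g \<in> circle_bounded" "h \<in> circle_bounded"
  shows "cinner (F \<odot> L2_of g) (L2_of h) = cinner F (L2_of (\<lambda>z. cnj (g z) * h z))"
proof -
  obtain f where "square_integrable f" "F = L2_of f" by (rule L2_representative)
  then show ?thesis
    using assms
    by (simp add: L2_mult_L2_of cinner_L2_of square_integrable_bounded square_integrable_mult_bounded
      circle_bounded_mult circle_bounded_cnj mult.assoc)
qed

lemma L2_of_bounded_add:
  "\<lbrakk>f \<in> circle_bounded; g \<in> circle_bounded\<rbrakk> \<Longrightarrow> L2_of (\<lambda>z. f z + g z) = L2_of f + L2_of g"
  by (simp add: L2_of_add square_integrable_bounded)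

lemma L2_of_bounded_scaleC:
  "f \<in> circle_bounded \<Longrightarrow> L2_of (\<lambda>z. c * f z) = c *\<^sub>C L2_of f"
  by (simp add: L2_of_scaleC square_integrable_bounded)

lemma norm_mult_bounded_le:
  assumes "g \<in> circle_bounded"
  obtains B where "\<And>F. norm (L2_of g \<odot> F) \<le> B * norm F"
proof -
  obtain B where B: "B \<ge> 0" "\<forall>z\<in>sphere 0 1. cmod (g z) \<le> B"
    using assms by (rule circle_boundedE)
  have norm_sq: "(norm (L2_of f))\<^sup>2 = (LINT z|circle. (cmod (f z))\<^sup>2)" if "square_integrable f" for f
  proof -
    have "complex_of_real ((norm (L2_of f))\<^sup>2) = (LINT z|circle. of_real ((cmod (f z))\<^sup>2))"
      unfolding cinner_self[symmetric] cinner_L2_of[OF that that] complex_norm_square ..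
    then show ?thesis by (simp only: integral_complex_of_real of_real_eq_iff)
  qed
  have "norm (L2_of g \<odot> F) \<le> B * norm F" for F
  proof -
    obtain f where f: "square_integrable f" "F = L2_of f" by (rule L2_representative)
    note sq = square_integrable_mult_bounded(1)[OF assms f(1)]
    have "(norm (L2_of g \<odot> F))\<^sup>2 = (LINT z|circle. (cmod (g z * f z))\<^sup>2)"
      using f sq assms by (simp add: L2_mult_L2_of square_integrable_bounded norm_sq)
    also have "\<dots> \<le> (LINT z|circle. B\<^sup>2 * (cmod (f z))\<^sup>2)"
    proof (rule integral_mono)
      show "integrable circle (\<lambda>z. (cmod (g z * f z))\<^sup>2)"
        using sq by (simp add: square_integrable_def)
      show "integrable circle (\<lambda>z. B\<^sup>2 * (cmod (f z))\<^sup>2)"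
        using f by (simp add: square_integrable_def)
      show "(cmod (g z * f z))\<^sup>2 \<le> B\<^sup>2 * (cmod (f z))\<^sup>2" if "z \<in> space circle" for z
      proof -
        have "cmod (g z) \<le> B" using B that by (simp add: space_circle)
        then have "(cmod (g z))\<^sup>2 \<le> B\<^sup>2" by (simp add: power_mono)
        then show ?thesis by (simp add: norm_mult power_mult_distrib mult_right_mono)
      qed
    qed
    also have "\<dots> = (B * norm F)\<^sup>2"
      by (simp only: f(2) power_mult_distrib norm_sq[OF f(1)] integral_mult_right_zero)
    finally show ?thesis
      by (rule power2_le_imp_le) (simp add: B(1))
  qed
  then show thesis by (rule that)
qed

section \<open>Boundary values of Hardy functions\<close>

text \<open>On a finite measure space, pointwise convergence together with a bound in \<open>L\<^sup>2\<close> gives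
  convergence in \<open>L\<^sup>1\<close>: above a height \<open>N\<close> the bound leaves mass at most \<open>K / N\<close>, and below it
  dominated convergence applies.\<close>

lemma (in finite_measure) tendsto_integral_zero_of_L2_bound:
  fixes h :: "nat \<Rightarrow> 'a \<Rightarrow> real"
  assumes [measurable]: "\<And>j. h j \<in> borel_measurable M"
    and pos: "\<And>j x. 0 \<le> h j x"
    and lim: "AE x in M. (\<lambda>j. h j x) \<longlonglongrightarrow> 0"
    and int: "\<And>j. integrable M (\<lambda>x. (h j x)\<^sup>2)"
    and bound: "\<And>j. (LINT x|M. (h j x)\<^sup>2) \<le> K"
  shows "(\<lambda>j. LINT x|M. h j x) \<longlonglongrightarrow> 0"
proof (rule LIMSEQ_I)
  fix e :: real assume e: "e > 0"
  define N where "N = 2 * (\<bar>K\<bar> + 1) / e"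
  have N: "N > 0" using e by (simp add: N_def)
  have KN: "K / N \<le> e / 2"
    using e by (simp add: N_def field_simps abs_if)
  have min_int: "integrable M (\<lambda>x. min (h j x) N)" for j
    by (rule integrable_const_bound[where B = N]) (use pos N in \<open>auto intro!: AE_I2\<close>)
  have "(\<lambda>j. LINT x|M. min (h j x) N) \<longlonglongrightarrow> (LINT x|M. 0)"
  proof (rule integral_dominated_convergence)
    show "integrable M (\<lambda>_. N)" by simp
    show "AE x in M. (\<lambda>j. min (h j x) N) \<longlonglongrightarrow> 0"
      using lim
    proof eventually_elim
      case (elim x)
      have "(\<lambda>j. min (h j x) N) \<longlonglongrightarrow> min 0 N"
        by (intro tendsto_intros elim)
      then show ?case using N by simp
    qed
    show "AE x in M. norm (min (h j x) N) \<le> N" for j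
      using pos N by (auto intro!: AE_I2)
  qed auto
  then obtain j0 where j0: "\<And>j. j \<ge> j0 \<Longrightarrow> \<bar>LINT x|M. min (h j x) N\<bar> < e / 2"
    using LIMSEQ_D[of _ 0 "e / 2"] e by fastforce
  have "norm ((LINT x|M. h j x) - 0) < e" if "j \<ge> j0" for j
  proof -
    have le: "h j x \<le> min (h j x) N + (h j x)\<^sup>2 / N" for x
    proof (cases "h j x \<le> N")
      case False
      then have "h j x * N \<le> (h j x)\<^sup>2"
        using pos[of j x] by (simp add: power2_eq_square mult_left_mono)
      then have "h j x \<le> (h j x)\<^sup>2 / N"
        using N by (simp add: field_simps)
      with False N show ?thesis by simp
    qed (use N in simp)
    have "integrable M (h j)"
      by (rule Bochner_Integration.integrable_bound[OF Bochner_Integration.integrable_add[OF min_int integrable_divide[OF int]]])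
        (use pos N le in \<open>auto intro!: AE_I2 order_trans[OF le abs_ge_self]\<close>)
    then have "(LINT x|M. h j x) \<le> (LINT x|M. min (h j x) N + (h j x)\<^sup>2 / N)"
      using int min_int le by (intro integral_mono) auto
    also have "\<dots> = (LINT x|M. min (h j x) N) + (LINT x|M. (h j x)\<^sup>2) / N"
      using int min_int by simp
    also have "\<dots> < e / 2 + e / 2"
      using j0[OF that] divide_right_mono[OF bound[of j], of N] N KN by linarith
    finally show ?thesis
      using pos by (simp add: abs_of_nonneg)
  qed
  then show "\<exists>no. \<forall>n\<ge>no. norm ((LINT x|M. h n x) - 0) < e" by blast
qed

text \<open>A sequence of radii tending to 1 from below, since dominated convergence is a statement about
  sequences.\<close>

definition radius :: "nat \<Rightarrow> real" where
  "radius j = 1 - inverse (real (Suc j))"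

lemma radius: "0 \<le> radius j" "radius j < 1"
  by (simp_all add: radius_def field_simps)

lemma radius_tendsto: "filterlim radius (at_left 1) sequentially"
proof -
  have "radius \<longlonglongrightarrow> 1"
    unfolding radius_def using LIMSEQ_inverse_real_of_nat_add_minus[of 1] by simp
  then show ?thesis
    by (simp add: filterlim_at radius less_imp_neq eventually_sequentially less_imp_le)
qed

lemma hardy_disk_dilation:
  assumes "hardy_disk F"
  shows "(\<lambda>z. F (of_real (radius j) * z)) \<in> disk_algebra"
proof -
  have F: "F holomorphic_on ball 0 1" using assms by (simp add: hardy_disk_def)
  have "(\<lambda>z. complex_of_real (radius j) * z) ` cball 0 1 \<subseteq> ball 0 1"
  proof (rule image_subsetI)
    fix z :: complex assume "z \<in> cball 0 1"
    then have "radius j * cmod z \<le> radius j * 1"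
      using radius[of j] by (intro mult_left_mono) auto
    then show "of_real (radius j) * z \<in> ball 0 1"
      using radius[of j] by (simp add: norm_mult)
  qed
  then have "(F \<circ> (\<lambda>z. of_real (radius j) * z)) holomorphic_on cball 0 1"
    by (intro holomorphic_on_compose_gen[OF _ F] holomorphic_intros)
  then have "(\<lambda>z. F (of_real (radius j) * z)) holomorphic_on cball 0 1"
    by (simp add: o_def)
  then show ?thesis
    by (auto simp: disk_algebra_def holomorphic_on_imp_continuous_on elim: holomorphic_on_subset)
qed

text \<open>The dilations are bounded in \<open>L\<^sup>2\<close> and converge almost everywhere to the boundary function,
  hence in \<open>L\<^sup>1\<close>. Cauchy's formula holds for the dilations, and this limit carries it over to
  the boundary function.\<close>

lemma hardy_pairing_tendsto:
  assumes F: "hardy_disk F"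
    and lim: "AE z in circle. ((\<lambda>r::real. F (of_real r * z)) \<longlongrightarrow> f z) (at_left 1)"
    and f: "square_integrable f" and g: "g \<in> circle_bounded"
  shows "(\<lambda>j. LINT z|circle. F (of_real (radius j) * z) * g z) \<longlonglongrightarrow> (LINT z|circle. f z * g z)"
proof -
  let ?F = "\<lambda>j z. F (of_real (radius j) * z)"
  obtain C where C: "\<And>r. r \<in> {0..<1::real} \<Longrightarrow> (LINT z|circle. (cmod (F (of_real r * z)))\<^sup>2) \<le> C"
    using F unfolding hardy_disk_def by blast
  obtain B where B: "B \<ge> 0" "\<forall>z\<in>sphere 0 1. cmod (g z) \<le> B"
    using g by (rule circle_boundedE)
  have sqF: "square_integrable (?F j)" for j
    by (intro square_integrable_bounded disk_algebra_circle_bounded hardy_disk_dilation F)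
  define h where "h = (\<lambda>j z. cmod (?F j z - f z))"
  have sqd: "square_integrable (\<lambda>z. ?F j z - f z)" for j
    using square_integrable_add[OF sqF square_integrable_uminus[OF f]] by simp
  have "(\<lambda>j. LINT z|circle. h j z) \<longlonglongrightarrow> 0"
  proof (rule circle.tendsto_integral_zero_of_L2_bound)
    show "h j \<in> borel_measurable circle" for j
      using sqd[of j] unfolding h_def by (auto simp: square_integrable_def)
    show "0 \<le> h j x" for j x by (simp add: h_def)
    show "AE z in circle. (\<lambda>j. h j z) \<longlonglongrightarrow> 0"
      using lim
    proof eventually_elim
      case (elim z)
      have "(\<lambda>j. ?F j z) \<longlonglongrightarrow> f z"
        by (rule filterlim_compose[OF elim radius_tendsto])
      then show ?case
        unfolding h_def by (simp add: LIM_zero tendsto_norm_zero)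
    qed
    show int: "integrable circle (\<lambda>z. (h j z)\<^sup>2)" for j
      using sqd[of j] unfolding h_def by (auto simp: square_integrable_def)
    show "(LINT z|circle. (h j z)\<^sup>2) \<le> 2 * C + 2 * (LINT z|circle. (cmod (f z))\<^sup>2)" for j
    proof -
      have i: "integrable circle (\<lambda>z. (cmod (?F j z))\<^sup>2)" "integrable circle (\<lambda>z. (cmod (f z))\<^sup>2)"
        using sqF[of j] f by (auto simp: square_integrable_def)
      have "(LINT z|circle. (h j z)\<^sup>2) \<le>
          (LINT z|circle. 2 * (cmod (?F j z))\<^sup>2 + 2 * (cmod (f z))\<^sup>2)"
      proof (rule integral_mono[OF int])
        show "integrable circle (\<lambda>z. 2 * (cmod (?F j z))\<^sup>2 + 2 * (cmod (f z))\<^sup>2)"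
          using i by simp
        fix z
        have "(h j z)\<^sup>2 \<le> (cmod (?F j z) + cmod (f z))\<^sup>2"
          unfolding h_def by (intro power_mono norm_triangle_ineq4 norm_ge_zero)
        also have "\<dots> \<le> 2 * (cmod (?F j z))\<^sup>2 + 2 * (cmod (f z))\<^sup>2"
          using sum_squares_bound[of "cmod (?F j z)" "cmod (f z)"] by (simp add: power2_sum)
        finally show "(h j z)\<^sup>2 \<le> 2 * (cmod (?F j z))\<^sup>2 + 2 * (cmod (f z))\<^sup>2" .
      qed
      also have "\<dots> = 2 * (LINT z|circle. (cmod (?F j z))\<^sup>2) + 2 * (LINT z|circle. (cmod (f z))\<^sup>2)"
        using i by simp
      finally show ?thesis
        using C[of "radius j"] radius[of j] by simp
    qed
  qed
  then have lim0: "(\<lambda>j. B * (LINT z|circle. h j z)) \<longlonglongrightarrow> 0"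
    by (rule tendsto_mult_right_zero)
  have int: "integrable circle (\<lambda>z. u z * g z)" if "square_integrable u" for u
    using integrable_mult_cnj[OF that square_integrable_bounded[OF circle_bounded_cnj[OF g]]] by simp
  have "norm ((LINT z|circle. ?F j z * g z) - (LINT z|circle. f z * g z)) \<le> B * (LINT z|circle. h j z)" for j
  proof -
    have "(LINT z|circle. ?F j z * g z) - (LINT z|circle. f z * g z) = (LINT z|circle. (?F j z - f z) * g z)"
      using int[OF sqF] int[OF f] by (simp add: left_diff_distrib)
    also have "norm \<dots> \<le> (LINT z|circle. norm ((?F j z - f z) * g z))"
      by (rule integral_norm_bound)
    also have "\<dots> \<le> (LINT z|circle. B * h j z)"
    proof (rule integral_mono)
      show "integrable circle (\<lambda>z. norm ((?F j z - f z) * g z))"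
        using int[OF sqd] by (rule integrable_norm)
      have "integrable circle (\<lambda>z. ?F j z - f z)"
        using integrable_mult_cnj[OF sqd square_integrable_bounded[OF circle_bounded_const_id(1)[of 1]]] by simp
      then show "integrable circle (\<lambda>z. B * h j z)"
        unfolding h_def by (intro integrable_mult_right integrable_norm)
      show "norm ((?F j z - f z) * g z) \<le> B * h j z" if "z \<in> space circle" for z
        using B that by (simp add: norm_mult h_def space_circle mult.commute mult_right_mono)
    qed
    finally show ?thesis by simp
  qed
  then have "(\<lambda>j. (LINT z|circle. ?F j z * g z) - (LINT z|circle. f z * g z)) \<longlonglongrightarrow> 0"
    by (intro Lim_null_comparison[OF _ lim0]) simp
  then show ?thesis by (rule LIM_zero_cancel)
qed

text \<open>Elements of \<open>H\<^sup>2\<close> have no Fourier coefficients of negative index. Every orthogonality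
  relation with an arbitrary element of \<open>H\<^sup>2\<close> comes from here.\<close>

lemma H2_cinner_cnj_eq_0:
  assumes "h \<in> H2" "G \<in> disk_algebra"
  shows "cinner h (L2_of (\<lambda>z. cnj (z * G z))) = 0"
proof -
  obtain f where f: "square_integrable f" "h = L2_of f" by (rule L2_representative)
  then obtain F where F: "hardy_disk F"
    "AE z in circle. ((\<lambda>r::real. F (of_real r * z)) \<longlongrightarrow> f z) (at_left 1)"
    using assms(1) H2_iff by blast
  have zG: "(\<lambda>z. z * G z) \<in> circle_bounded"
    by (intro disk_algebra_circle_bounded disk_algebra_intros assms)
  have "(LINT z|circle. F (of_real (radius j) * z) * (z * G z)) = 0" for j
    using circle_mean_shift[OF disk_algebra_intros(5)[OF hardy_disk_dilation[OF F(1)] assms(2)], of j]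
    by (simp add: mult_ac)
  with hardy_pairing_tendsto[OF F f(1) zG]
  have "(LINT z|circle. f z * (z * G z)) = 0"
    by (simp add: LIMSEQ_const_iff)
  then show ?thesis
    using f zG circle_bounded_cnj[OF zG] by (simp add: cinner_L2_of square_integrable_bounded)
qed

lemma disk_algebra_radial_limit:
  assumes "G \<in> disk_algebra" and z: "z \<in> sphere 0 1"
  shows "((\<lambda>r::real. G (of_real r * z)) \<longlongrightarrow> G z) (at_left 1)"
proof -
  have "continuous_on (cball 0 1) G"
    using assms by (simp add: disk_algebra_def)
  then have "continuous_on {0..1} (\<lambda>r::real. G (of_real r * z))"
    by (rule continuous_on_compose2) (use z in \<open>auto intro!: continuous_intros simp: norm_mult\<close>)
  then have "((\<lambda>r::real. G (of_real r * z)) \<longlongrightarrow> G (of_real 1 * z)) (at 1 within {0..1})"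
    by (simp only: continuous_on_def) (rule bspec[where x = 1], assumption, simp)
  then show ?thesis
    by (simp add: at_within_Icc_at_left)
qed

lemma disk_algebra_H2:
  assumes "G \<in> disk_algebra"
  shows "L2_of G \<in> H2"
proof -
  have sq: "square_integrable G"
    by (intro square_integrable_bounded disk_algebra_circle_bounded assms)
  have cont: "continuous_on (cball 0 1) G" and hol: "G holomorphic_on ball 0 1"
    using assms by (auto simp: disk_algebra_def)
  have "compact (G ` cball 0 1)"
    by (intro compact_continuous_image cont) simp
  then obtain B where B: "\<And>z. z \<in> cball 0 1 \<Longrightarrow> cmod (G z) \<le> B"
    by (meson compact_imp_bounded bounded_iff imageI)
  have rz: "of_real r * z \<in> cball 0 1" if "r \<in> {0..1::real}" "z \<in> sphere 0 1" for r and z :: complex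
    using that by (simp add: norm_mult)
  have "hardy_disk G"
    unfolding hardy_disk_def
  proof (intro conjI hol exI ballI)
    fix r :: real assume r: "r \<in> {0..<1}"
    have bd: "cmod (G (of_real r * z)) \<le> B" if "z \<in> sphere 0 1" for z
      using r that by (intro B rz) auto
    have "continuous_on (sphere 0 1) (\<lambda>z. G (of_real r * z))"
      by (rule continuous_on_compose2[OF cont]) (use rz r in \<open>auto intro!: continuous_intros simp: norm_mult\<close>)
    then have "(\<lambda>z. G (of_real r * z)) \<in> circle_bounded"
      by (rule continuous_circle_bounded)
    then have "integrable circle (\<lambda>z. (cmod (G (of_real r * z)))\<^sup>2)"
      using square_integrable_bounded by (auto simp: square_integrable_def)
    then have "(LINT z|circle. (cmod (G (of_real r * z)))\<^sup>2) \<le> (LINT z|circle. B\<^sup>2)"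
      by (rule integral_mono) (use bd in \<open>auto simp: space_circle power_mono\<close>)
    then show "(LINT z|circle. (cmod (G (of_real r * z)))\<^sup>2) \<le> measure circle (space circle) *\<^sub>R B\<^sup>2"
      by simp
  qed
  moreover have "AE z in circle. ((\<lambda>r::real. G (of_real r * z)) \<longlongrightarrow> G z) (at_left 1)"
    using disk_algebra_radial_limit[OF assms] by (intro AE_I2) (simp add: space_circle)
  ultimately show ?thesis
    using H2_iff[OF sq] by blast
qed

section \<open>Finite-dimensional subspaces\<close>

definition fin_dim :: "L2 set \<Rightarrow> bool" where
  "fin_dim V \<longleftrightarrow> (\<exists>B. finite B \<and> V = L2.span B)"

text \<open>A Parseval frame of \<open>V\<close>; it does the work of an orthonormal basis.\<close>

definition frame :: "L2 set \<Rightarrow> L2 set \<Rightarrow> bool" where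
  "frame V W \<longleftrightarrow> finite W \<and> W \<subseteq> V \<and> (\<forall>f\<in>V. f = (\<Sum>w\<in>W. cinner f w *\<^sub>C w))"

lemma fin_dim_subspace: "fin_dim V \<Longrightarrow> L2.subspace V"
  by (auto simp: fin_dim_def L2.subspace_span)

text \<open>One step of Gram-Schmidt orthogonalization for each spanning vector.\<close>

lemma frame_exists:
  assumes "fin_dim V"
  obtains W where "frame V W"
proof -
  have "finite B \<Longrightarrow> \<exists>W. frame (L2.span B) W" for B
  proof (induction rule: finite_induct)
    case empty
    show ?case by (rule exI[of _ "{}"]) (simp add: frame_def)
  next
    case (insert x B)
    then obtain W where "frame (L2.span B) W" by blast
    then have W: "finite W" "W \<subseteq> L2.span B"
      and expand: "\<And>f. f \<in> L2.span B \<Longrightarrow> f = (\<Sum>w\<in>W. cinner f w *\<^sub>C w)"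
      by (auto simp: frame_def)
    define x' where "x' = (\<Sum>w\<in>W. cinner x w *\<^sub>C w)"
    define u where "u = x - x'"
    have x': "x' \<in> L2.span B"
      unfolding x'_def using W(2) by (intro L2.span_sum L2.span_scale) auto
    have orth: "cinner f u = 0" if "f \<in> L2.span B" for f
    proof -
      have "cinner f x' = (\<Sum>w\<in>W. cinner f w * cinner w x)"
        unfolding x'_def by (simp add: cinner_simps flip: cinner_commute) (simp add: mult.commute)
      also have "\<dots> = cinner (\<Sum>w\<in>W. cinner f w *\<^sub>C w) x"
        by (simp add: cinner_simps)
      also have "\<dots> = cinner f x"
        using expand[OF that] by simp
      finally show ?thesis by (simp add: u_def cinner_simps)
    qed
    have dec: "\<exists>c f. f \<in> L2.span B \<and> y = f + c *\<^sub>C u" if y: "y \<in> L2.span (insert x B)" for y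
    proof -
      obtain c where c: "y - c *\<^sub>C x \<in> L2.span B"
        using y by (auto simp: L2.span_insert)
      have "y - c *\<^sub>C x + c *\<^sub>C x' \<in> L2.span B"
        by (intro L2.span_add L2.span_scale c x')
      moreover have "y = y - c *\<^sub>C x + c *\<^sub>C x' + c *\<^sub>C u"
        by (simp add: u_def L2.scale_right_diff_distrib)
      ultimately show ?thesis by blast
    qed
    show ?case
    proof (cases "u = 0")
      case True
      then have "L2.span (insert x B) = L2.span B"
        using x' by (simp add: u_def L2.span_redundant)
      then show ?thesis using \<open>frame (L2.span B) W\<close> by auto
    next
      case False
      define v where "v = inverse (of_real (norm u)) *\<^sub>C u"
      have vv: "cinner v v = 1"
        using False by (simp add: v_def cinner_self norm_scaleC norm_inverse)
      have uv: "u = of_real (norm u) *\<^sub>C v"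
        using False by (simp add: v_def)
      have fv: "cinner f v = 0" if "f \<in> L2.span B" for f
        using orth[OF that] by (simp add: v_def cinner_simps)
      have vf: "cinner v f = 0" if "f \<in> L2.span B" for f
        using fv[OF that] cinner_commute[of v f] by simp
      have "v \<notin> W"
        using vf[of v] W(2) vv by auto
      have "u \<in> L2.span (insert x B)"
        unfolding u_def using x' L2.span_mono[of B "insert x B"]
        by (intro L2.span_diff) (auto intro: L2.span_base)
      then have v: "v \<in> L2.span (insert x B)"
        unfolding v_def by (rule L2.span_scale)
      have "y = (\<Sum>w\<in>insert v W. cinner y w *\<^sub>C w)" if y: "y \<in> L2.span (insert x B)" for y
      proof -
        obtain c f where f: "f \<in> L2.span B" and "y = f + c *\<^sub>C u"
          using dec[OF y] by blast
        then have y': "y = f + (c * of_real (norm u)) *\<^sub>C v"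
          using uv by (metis L2.scale_scale)
        have "(\<Sum>w\<in>W. cinner y w *\<^sub>C w) = (\<Sum>w\<in>W. cinner f w *\<^sub>C w)"
          using W(2) vf by (intro sum.cong) (auto simp: y' cinner_simps)
        also have "\<dots> = f" using expand[OF f] by simp
        finally show ?thesis
          using \<open>v \<notin> W\<close> W(1) fv[OF f] vv by (simp add: y' cinner_simps)
      qed
      moreover have "insert v W \<subseteq> L2.span (insert x B)"
        using v W(2) L2.span_mono[of B "insert x B"] by auto
      ultimately show ?thesis
        using W(1) by (auto simp: frame_def intro!: exI[of _ "insert v W"])
    qed
  qed
  with assms that show thesis by (auto simp: fin_dim_def)
qed

lemma cinner_eqI:
  assumes "L2.subspace V" "f \<in> V" "g \<in> V" "\<And>h. h \<in> V \<Longrightarrow> cinner f h = cinner g h"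
  shows "f = g"
proof -
  have "f - g \<in> V" using assms by (intro L2.subspace_diff)
  then have "cinner (f - g) (f - g) = 0"
    using assms(4) by (simp add: cinner_diff_left)
  then show ?thesis by (simp add: cinner_eq_zero_iff)
qed

lemma riesz_representation:
  assumes "fin_dim V"
    and add: "\<And>f g. \<lbrakk>f \<in> V; g \<in> V\<rbrakk> \<Longrightarrow> l (f + g) = l f + l g"
    and scale: "\<And>c f. f \<in> V \<Longrightarrow> l (c *\<^sub>C f) = c * l f"
  obtains g where "g \<in> V" "\<forall>f\<in>V. l f = cinner f g"
proof -
  obtain W where "frame V W" using assms(1) by (rule frame_exists)
  then have W: "finite W" "W \<subseteq> V" and expand: "\<And>f. f \<in> V \<Longrightarrow> f = (\<Sum>w\<in>W. cinner f w *\<^sub>C w)"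
    by (auto simp: frame_def)
  note sub = fin_dim_subspace[OF assms(1)]
  have l0: "l 0 = 0"
    using scale[of 0 0] L2.subspace_0[OF sub] by simp
  have sum: "finite X \<Longrightarrow> X \<subseteq> V \<Longrightarrow> l (\<Sum>w\<in>X. c w *\<^sub>C w) = (\<Sum>w\<in>X. c w * l w)" for X c
    by (induction rule: finite_induct)
      (use sub in \<open>auto simp: l0 add scale L2.subspace_sum L2.subspace_scale subset_eq\<close>)
  define g where "g = (\<Sum>w\<in>W. cnj (l w) *\<^sub>C w)"
  have "g \<in> V"
    unfolding g_def using W sub by (intro L2.subspace_sum L2.subspace_scale) auto
  moreover have "l f = cinner f g" if "f \<in> V" for f
  proof -
    have "l f = l (\<Sum>w\<in>W. cinner f w *\<^sub>C w)"
      using expand[OF that] by simp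
    also have "\<dots> = cinner f g"
      unfolding sum[OF W] g_def by (simp add: cinner_simps mult.commute)
    finally show ?thesis .
  qed
  ultimately show thesis using that by blast
qed

lemma proj_eqI:
  assumes "L2.subspace V" "g \<in> V" "\<And>h. h \<in> V \<Longrightarrow> cinner f h = cinner g h"
  shows "proj V f = g"
  unfolding proj_def
proof (rule the_equality)
  show "g \<in> V \<and> (\<forall>h\<in>V. cinner (f - g) h = 0)"
    using assms by (simp add: cinner_diff_left)
  fix k assume "k \<in> V \<and> (\<forall>h\<in>V. cinner (f - k) h = 0)"
  then show "k = g"
    using assms by (intro cinner_eqI[OF assms(1)]) (auto simp: cinner_diff_left)
qed

lemma
  assumes "fin_dim V"
  shows proj_in: "proj V f \<in> V"
    and cinner_proj: "h \<in> V \<Longrightarrow> cinner (proj V f) h = cinner f h"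
proof -
  obtain g where g: "g \<in> V" "\<forall>h\<in>V. cinner h f = cinner h g"
    using riesz_representation[OF assms, of "\<lambda>h. cinner h f"] by (auto simp: cinner_simps)
  have eq: "cinner f h = cinner g h" if "h \<in> V" for h
    using g(2) that cinner_commute[of f h] cinner_commute[of g h] by simp
  have "proj V f = g"
    using fin_dim_subspace[OF assms] g(1) eq by (rule proj_eqI)
  then show "proj V f \<in> V" "h \<in> V \<Longrightarrow> cinner (proj V f) h = cinner f h"
    using g(1) eq by simp_all
qed

lemma norm_proj_le:
  assumes "fin_dim V"
  shows "norm (proj V f) \<le> norm f"
proof (cases "norm (proj V f) = 0")
  case False
  have "cinner (proj V f) (proj V f) = cinner f (proj V f)"
    by (rule cinner_proj[OF assms proj_in[OF assms]])
  then have "(norm (proj V f))\<^sup>2 = cmod (cinner f (proj V f))"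
    unfolding cinner_self by (metis abs_norm_cancel abs_power2 norm_of_real)
  also have "\<dots> \<le> norm f * norm (proj V f)"
    by (rule norm_cinner_le)
  finally show ?thesis
    using False by (simp add: power2_eq_square)
qed simp

lemma
  assumes "fin_dim V" "clinear_on V V T" "g \<in> V"
  shows adjoint_on_in: "adjoint_on V T g \<in> V"
    and cinner_adjoint_on: "f \<in> V \<Longrightarrow> cinner (T f) g = cinner f (adjoint_on V T g)"
proof -
  have T: "\<And>f g. \<lbrakk>f \<in> V; g \<in> V\<rbrakk> \<Longrightarrow> T (f + g) = T f + T g" "\<And>c f. f \<in> V \<Longrightarrow> T (c *\<^sub>C f) = c *\<^sub>C T f"
    using assms(2) by (auto simp: clinear_on_def)
  obtain h where h: "h \<in> V" "\<forall>f\<in>V. cinner (T f) g = cinner f h"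
    using riesz_representation[OF assms(1), of "\<lambda>f. cinner (T f) g"] T by (auto simp: cinner_simps)
  have "adjoint_on V T g = h"
    unfolding adjoint_on_def
  proof (rule the_equality)
    show "h \<in> V \<and> (\<forall>f\<in>V. cinner (T f) g = cinner f h)" using h by blast
    fix k assume k: "k \<in> V \<and> (\<forall>f\<in>V. cinner (T f) g = cinner f k)"
    show "k = h"
    proof (rule cinner_eqI[OF fin_dim_subspace[OF assms(1)]])
      fix f assume "f \<in> V"
      then show "cinner k f = cinner h f"
        using h k cinner_commute[of k f] cinner_commute[of h f] by auto
    qed (use h k in auto)
  qed
  then show "adjoint_on V T g \<in> V" "f \<in> V \<Longrightarrow> cinner (T f) g = cinner f (adjoint_on V T g)"
    using h by auto
qed

text \<open>In a finite-dimensional space a weakly bounded sequence pairs with a weak null sequence to a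
  null sequence, because a frame turns the inner product into a finite sum.\<close>

lemma tendsto_cinner_weakly_null:
  assumes "fin_dim V" "\<And>k. u k \<in> V"
    and bounded: "\<And>w. w \<in> V \<Longrightarrow> \<exists>C. \<forall>k. cmod (cinner (u k) w) \<le> C"
    and null: "\<And>w. w \<in> V \<Longrightarrow> (\<lambda>k. cinner w (x k)) \<longlonglongrightarrow> 0"
  shows "(\<lambda>k. cinner (u k) (x k)) \<longlonglongrightarrow> 0"
proof -
  obtain W where "frame V W" using assms(1) by (rule frame_exists)
  then have W: "finite W" "W \<subseteq> V" and expand: "\<And>f. f \<in> V \<Longrightarrow> f = (\<Sum>w\<in>W. cinner f w *\<^sub>C w)"
    by (auto simp: frame_def)
  have "cinner (u k) (x k) = (\<Sum>w\<in>W. cinner (u k) w * cinner w (x k))" for k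
  proof -
    have "cinner (u k) (x k) = cinner (\<Sum>w\<in>W. cinner (u k) w *\<^sub>C w) (x k)"
      using expand[OF assms(2)[of k]] by simp
    then show ?thesis by (simp add: cinner_simps)
  qed
  moreover have "(\<lambda>k. \<Sum>w\<in>W. cinner (u k) w * cinner w (x k)) \<longlonglongrightarrow> 0"
  proof (rule tendsto_null_sum)
    fix w assume "w \<in> W"
    then have w: "w \<in> V" using W by auto
    obtain C where C: "\<forall>k. cmod (cinner (u k) w) \<le> C" using bounded[OF w] by blast
    have lim: "(\<lambda>k. C * cmod (cinner w (x k))) \<longlonglongrightarrow> 0"
      using tendsto_norm_zero[OF null[OF w]] by (rule tendsto_mult_right_zero)
    show "(\<lambda>k. cinner (u k) w * cinner w (x k)) \<longlonglongrightarrow> 0"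
      by (rule Lim_null_comparison[OF _ lim])
        (use C in \<open>auto simp: norm_mult intro!: always_eventually mult_right_mono\<close>)
  qed
  ultimately show ?thesis by simp
qed

subsection \<open>Fourier coefficients tend to zero\<close>

lemma cinner_powers:
  "cinner (L2_of (\<lambda>z. z ^ j)) (L2_of (\<lambda>z. z ^ k)) = (if j = k then 1 else 0)"
proof -
  have "measure circle (space circle) = 1"
    using measure_circle(2) by (simp add: measure_def)
  then have eq: "(LINT z|circle. z ^ j * cnj z ^ j) = 1" for j
    by (subst Bochner_Integration.integral_cong[where g = "\<lambda>z. 1"])
       (auto simp: space_circle complex_norm_square[symmetric] simp flip: power_mult_distrib)
  have lt: "(LINT z|circle. z ^ j * cnj z ^ k) = 0" if "k < j" for j k
  proof -
    have "(LINT z|circle. z ^ j * cnj z ^ k) = (LINT z|circle. z * z ^ (j - k - 1))"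
    proof (rule Bochner_Integration.integral_cong)
      fix z assume "z \<in> space circle"
      then have "z * cnj z = 1" by (simp add: space_circle complex_norm_square[symmetric])
      have "z ^ j * cnj z ^ k = (z * cnj z) ^ k * z ^ (j - k)"
        using that by (simp add: power_mult_distrib mult_ac flip: power_add)
      also have "\<dots> = z * z ^ (j - k - 1)"
        using \<open>z * cnj z = 1\<close> Suc_diff_Suc[OF that] by (simp flip: power_Suc)
      finally show "z ^ j * cnj z ^ k = z * z ^ (j - k - 1)" .
    qed simp
    also have "\<dots> = 0"
      by (intro circle_mean_shift disk_algebra_intros)
    finally show ?thesis .
  qed
  have c: "cinner (L2_of (\<lambda>z. z ^ j)) (L2_of (\<lambda>z. z ^ k)) = (LINT z|circle. z ^ j * cnj z ^ k)" for j k
    by (simp add: cinner_bounded circle_bounded_power)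
  consider "j = k" | "j < k" | "k < j" by linarith
  then show ?thesis
  proof cases
    case 2
    then show ?thesis
      using lt[OF 2] c[of k j] cinner_commute[of "L2_of (\<lambda>z. z ^ j)" "L2_of (\<lambda>z. z ^ k)"] by simp
  qed (use eq lt c in auto)
qed

text \<open>Bessel's inequality makes the squares of the coefficients summable.\<close>

lemma cinner_power_tendsto_0: "(\<lambda>k. cinner F (L2_of (\<lambda>z. z ^ k))) \<longlonglongrightarrow> 0"
proof -
  define e where "e = (\<lambda>k. L2_of (\<lambda>z. z ^ k))"
  define c where "c = (\<lambda>k. cinner F (e k))"
  have ee: "cinner (e j) (e k) = (if j = k then 1 else 0)" for j k
    by (simp add: e_def cinner_powers)
  have bound: "(\<Sum>k<N. (cmod (c k))\<^sup>2) \<le> (norm F)\<^sup>2" for N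
  proof -
    define s where "s = (\<Sum>k<N. c k *\<^sub>C e k)"
    have se: "cinner s (e k) = c k" if "k < N" for k
      using that by (simp add: s_def cinner_simps ee if_distrib cong: if_cong)
    have Fs: "cinner F s = (\<Sum>k<N. c k * cnj (c k))"
      by (simp add: s_def cinner_simps c_def mult.commute)
    have ss: "cinner s s = (\<Sum>k<N. c k * cnj (c k))"
      by (subst (2) s_def) (simp add: cinner_simps se mult.commute)
    have "cinner (F - s) (F - s) = cinner F F - cinner s s"
      using Fs ss cinner_commute[of s F] by (simp add: cinner_simps mult.commute)
    then have "complex_of_real ((norm (F - s))\<^sup>2) = of_real ((norm F)\<^sup>2 - (\<Sum>k<N. (cmod (c k))\<^sup>2))"
      unfolding cinner_self[of F] cinner_self[of "F - s"] ss
      by (simp only: complex_norm_square of_real_diff of_real_sum)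
    then have "(norm (F - s))\<^sup>2 = (norm F)\<^sup>2 - (\<Sum>k<N. (cmod (c k))\<^sup>2)"
      by (simp only: of_real_eq_iff)
    then show ?thesis
      using zero_le_power2[of "norm (F - s)"] by linarith
  qed
  have "summable (\<lambda>k. (cmod (c k))\<^sup>2)"
    by (rule summableI_nonneg_bounded[where x = "(norm F)\<^sup>2"]) (use bound in auto)
  then have "(\<lambda>k. (cmod (c k))\<^sup>2) \<longlonglongrightarrow> 0"
    by (rule summable_LIMSEQ_zero)
  then have "(\<lambda>k. sqrt ((cmod (c k))\<^sup>2)) \<longlonglongrightarrow> sqrt 0"
    by (rule tendsto_real_sqrt)
  then show ?thesis
    by (simp add: c_def e_def tendsto_norm_zero_iff)
qed

section \<open>The model space of a finite Blaschke product\<close>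

text \<open>Each factor satisfies \<open>z - w = z (cnj (1 - (cnj w) z))\<close> on the circle, so with
  \<open>q = (\<Prod>i<n. 1 - cnj (w i) * z)\<close> numerator and denominator are conjugate up to \<open>z\<^sup>n\<close>.\<close>

lemma finite_blaschke_factorization:
  assumes "finite_blaschke n \<alpha>"
  obtains c q where "cmod c = 1" "q \<in> disk_algebra" "\<And>z. z \<in> cball 0 1 \<Longrightarrow> q z \<noteq> 0"
    "\<alpha> \<in> disk_algebra" "\<And>z. z \<in> sphere 0 1 \<Longrightarrow> \<alpha> z = c * z ^ n * cnj (q z) / q z"
proof -
  obtain c w where c: "cmod c = 1" and w: "\<forall>i<n. cmod (w i) < 1"
    and eq: "\<forall>z\<in>cball 0 1. \<alpha> z = c * (\<Prod>i<n. (z - w i) / (1 - cnj (w i) * z))"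
    using assms unfolding finite_blaschke_def by blast
  have \<alpha>: "\<And>z. z \<in> cball 0 1 \<Longrightarrow> \<alpha> z = c * (\<Prod>i<n. (z - w i) / (1 - cnj (w i) * z))"
    using eq by blast
  define q where "q = (\<lambda>z. \<Prod>i<n. 1 - cnj (w i) * z)"
  have nz: "1 - cnj (w i) * z \<noteq> 0" if "z \<in> cball 0 1" "i < n" for z i
  proof
    assume "1 - cnj (w i) * z = 0"
    then have "cmod (cnj (w i) * z) = 1" by (metis eq_iff_diff_eq_0 norm_one)
    moreover have "cmod (w i) * cmod z \<le> cmod (w i) * 1"
      using that by (intro mult_left_mono) auto
    ultimately show False using w that(2) by (auto simp: norm_mult)
  qed
  have qd: "q \<in> disk_algebra"
    unfolding q_def by (intro disk_algebra_intros)
  have "\<alpha> \<in> disk_algebra"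
    by (rule disk_algebra_cong[OF \<alpha>], assumption, intro disk_algebra_intros nz) auto
  moreover have "\<alpha> z = c * z ^ n * cnj (q z) / q z" if z: "z \<in> sphere 0 1" for z
  proof -
    have "z - w i = z * cnj (1 - cnj (w i) * z)" for i
      using sphere_mult_cnj[OF z] by (simp add: right_diff_distrib mult.left_commute)
    then have "(\<Prod>i<n. (z - w i) / (1 - cnj (w i) * z)) =
        (\<Prod>i<n. z * cnj (1 - cnj (w i) * z)) / (\<Prod>i<n. 1 - cnj (w i) * z)"
      by (simp only: prod_dividef)
    also have "(\<Prod>i<n. z * cnj (1 - cnj (w i) * z)) = z ^ n * cnj (q z)"
      unfolding q_def by (simp add: prod.distrib)
    finally show ?thesis
      using \<alpha>[of z] z by (simp add: q_def)
  qed
  moreover have "q z \<noteq> 0" if "z \<in> cball 0 1" for z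
    using nz[OF that] by (auto simp: q_def)
  ultimately show thesis
    using c qd that by blast
qed

lemma finite_blaschke_disk_algebra: "finite_blaschke n \<alpha> \<Longrightarrow> \<alpha> \<in> disk_algebra"
  by (erule finite_blaschke_factorization)

lemma finite_blaschke_unimodular:
  assumes "finite_blaschke n \<alpha>" "z \<in> sphere 0 1"
  shows "\<alpha> z * cnj (\<alpha> z) = 1"
proof -
  obtain c q where "cmod c = 1" "\<And>z. z \<in> cball 0 1 \<Longrightarrow> q z \<noteq> 0"
    "\<And>z. z \<in> sphere 0 1 \<Longrightarrow> \<alpha> z = c * z ^ n * cnj (q z) / q z"
    using assms(1) by (rule finite_blaschke_factorization) blast
  then have "cmod c = 1" "q z \<noteq> 0" "\<alpha> z = c * z ^ n * cnj (q z) / q z"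
    using assms(2) by auto
  then have "cmod (\<alpha> z) = 1"
    using assms(2) by (simp add: norm_mult norm_divide norm_power)
  then show ?thesis by (simp add: complex_norm_square[symmetric])
qed

text \<open>Boundary functions of elements of the model space: a function \<open>f\<close> in the disk algebra together
  with its conjugate \<open>u\<close>, the function with \<open>u z = cnj z * \<alpha> z * cnj (f z)\<close> on the circle. That
  \<open>f\<close> is orthogonal to \<open>\<alpha> H\<^sup>2\<close> means that \<open>u\<close> extends analytically to the disk too.\<close>

definition model_pair :: "(complex \<Rightarrow> complex) \<Rightarrow> (complex \<Rightarrow> complex) \<Rightarrow> (complex \<Rightarrow> complex) \<Rightarrow> bool" where
  "model_pair \<alpha> f u \<longleftrightarrow> f \<in> disk_algebra \<and> u \<in> disk_algebra \<and>
     (\<forall>z\<in>sphere 0 1. f z = \<alpha> z * cnj (z * u z))"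

lemma model_pair_bounded:
  "model_pair \<alpha> f u \<Longrightarrow> f \<in> circle_bounded" "model_pair \<alpha> f u \<Longrightarrow> u \<in> circle_bounded"
  by (auto simp: model_pair_def disk_algebra_circle_bounded)

lemma L2_of_model_pair:
  assumes \<alpha>: "finite_blaschke n \<alpha>" and f: "model_pair \<alpha> f u"
  shows "L2_of f \<in> model_space \<alpha>"
proof -
  have \<alpha>b: "\<alpha> \<in> circle_bounded"
    by (intro disk_algebra_circle_bounded finite_blaschke_disk_algebra[OF \<alpha>])
  have fd: "f \<in> disk_algebra" "u \<in> disk_algebra"
    and rel: "\<And>z. z \<in> sphere 0 1 \<Longrightarrow> f z = \<alpha> z * cnj (z * u z)"
    using f by (auto simp: model_pair_def)
  have "cinner (L2_of f) (L2_of \<alpha> \<odot> h) = 0" if "h \<in> H2" for h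
  proof -
    have "cinner (h \<odot> L2_of \<alpha>) (L2_of f) = cinner h (L2_of (\<lambda>z. cnj (\<alpha> z) * f z))"
      by (rule cinner_mult_bounded[OF \<alpha>b disk_algebra_circle_bounded[OF fd(1)]])
    also have "L2_of (\<lambda>z. cnj (\<alpha> z) * f z) = L2_of (\<lambda>z. cnj (z * u z))"
    proof (rule L2_of_cong)
      fix z :: complex assume z: "z \<in> sphere 0 1"
      show "cnj (\<alpha> z) * f z = cnj (z * u z)"
      proof -
        have "cnj (\<alpha> z) * f z = (\<alpha> z * cnj (\<alpha> z)) * cnj (z * u z)"
          by (simp only: rel[OF z] mult_ac)
        then show ?thesis by (simp add: finite_blaschke_unimodular[OF \<alpha> z])
      qed
    qed
    also have "cinner h \<dots> = 0"
      by (rule H2_cinner_cnj_eq_0[OF that fd(2)])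
    finally show ?thesis
      using cinner_commute[of "L2_of f" "h \<odot> L2_of \<alpha>"] by (simp add: L2_mult_commute)
  qed
  then show ?thesis
    using disk_algebra_H2[OF fd(1)] by (simp add: model_space_def)
qed

lemma model_space_orthogonal:
  assumes "finite_blaschke n \<alpha>" "h \<in> disk_algebra" "F \<in> model_space \<alpha>"
  shows "cinner F (L2_of (\<lambda>z. \<alpha> z * h z)) = 0" "cinner (L2_of (\<lambda>z. \<alpha> z * h z)) F = 0"
proof -
  have "cinner F (L2_of \<alpha> \<odot> L2_of h) = 0"
    using assms(3) disk_algebra_H2[OF assms(2)] by (simp add: model_space_def)
  then show *: "cinner F (L2_of (\<lambda>z. \<alpha> z * h z)) = 0"
    using assms(1,2) by (simp add: L2_mult_bounded disk_algebra_circle_bounded finite_blaschke_disk_algebra)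
  show "cinner (L2_of (\<lambda>z. \<alpha> z * h z)) F = 0"
    using * cinner_commute[of "L2_of (\<lambda>z. \<alpha> z * h z)" F] by simp
qed

subsection \<open>Taylor coefficients of Hardy functions\<close>

lemma hardy_disk_mult:
  assumes G: "G \<in> disk_algebra" and F: "hardy_disk F"
  shows "hardy_disk (\<lambda>z. G z * F z)"
proof -
  have cont: "continuous_on (cball 0 1) G" and hol: "G holomorphic_on ball 0 1"
    using G by (auto simp: disk_algebra_def)
  have F': "F holomorphic_on ball 0 1" using F by (simp add: hardy_disk_def)
  obtain C where C: "\<forall>r\<in>{0..<1::real}. (LINT z|circle. (cmod (F (of_real r * z)))\<^sup>2) \<le> C"
    using F unfolding hardy_disk_def by blast
  have "compact (G ` cball 0 1)"
    by (intro compact_continuous_image cont) simp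
  then obtain B where B: "\<And>z. z \<in> cball 0 1 \<Longrightarrow> cmod (G z) \<le> B"
    by (meson compact_imp_bounded bounded_iff imageI)
  have "(LINT z|circle. (cmod (G (of_real r * z) * F (of_real r * z)))\<^sup>2) \<le> B\<^sup>2 * C"
    if r: "r \<in> {0..<1}" for r :: real
  proof -
    have rz: "of_real r * z \<in> ball 0 1" if "z \<in> sphere 0 1" for z :: complex
      using r that by (simp add: norm_mult)
    have cF: "continuous_on (sphere 0 1) (\<lambda>z. F (of_real r * z))"
      by (rule continuous_on_compose2[OF holomorphic_on_imp_continuous_on[OF F']])
         (use rz in \<open>auto intro!: continuous_intros\<close>)
    have cG: "continuous_on (sphere 0 1) (\<lambda>z. G (of_real r * z))"
      by (rule continuous_on_compose2[OF holomorphic_on_imp_continuous_on[OF hol]])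
         (use rz in \<open>auto intro!: continuous_intros\<close>)
    have sq: "square_integrable (\<lambda>z. F (of_real r * z))"
        "square_integrable (\<lambda>z. G (of_real r * z) * F (of_real r * z))"
      by (intro square_integrable_bounded continuous_circle_bounded continuous_intros cF cG)+
    have "(LINT z|circle. (cmod (G (of_real r * z) * F (of_real r * z)))\<^sup>2) \<le>
        (LINT z|circle. B\<^sup>2 * (cmod (F (of_real r * z)))\<^sup>2)"
    proof (rule integral_mono)
      fix z assume "z \<in> space circle"
      then have "cmod (G (of_real r * z)) \<le> B"
        using rz by (intro B) (simp add: space_circle less_imp_le)
      then have "(cmod (G (of_real r * z)))\<^sup>2 \<le> B\<^sup>2" by (simp add: power_mono)
      then show "(cmod (G (of_real r * z) * F (of_real r * z)))\<^sup>2 \<le> B\<^sup>2 * (cmod (F (of_real r * z)))\<^sup>2"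
        by (simp add: norm_mult power_mult_distrib mult_right_mono)
    qed (use sq in \<open>auto simp: square_integrable_def\<close>)
    also have "\<dots> = B\<^sup>2 * (LINT z|circle. (cmod (F (of_real r * z)))\<^sup>2)"
      by (rule integral_mult_right_zero)
    also have "\<dots> \<le> B\<^sup>2 * C"
      using C r by (intro mult_left_mono) auto
    finally show ?thesis .
  qed
  moreover have "(\<lambda>z. G z * F z) holomorphic_on ball 0 1"
    by (intro holomorphic_intros hol F')
  ultimately show ?thesis
    unfolding hardy_disk_def by blast
qed

text \<open>Cauchy's formula on the dilations, in the limit.\<close>

lemma hardy_coefficient:
  assumes F: "hardy_disk F"
    and lim: "AE z in circle. ((\<lambda>r::real. F (of_real r * z)) \<longlongrightarrow> f z) (at_left 1)"
    and f: "square_integrable f"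
  shows "(LINT z|circle. f z * cnj z ^ k) = (deriv ^^ k) F 0 / fact k"
proof -
  have hol: "F holomorphic_on ball 0 1" using F by (simp add: hardy_disk_def)
  have "(LINT z|circle. F (of_real (radius j) * z) * cnj z ^ k) =
      of_real (radius j) ^ k * ((deriv ^^ k) F 0 / fact k)" for j
  proof -
    have in_ball: "of_real (radius j) * z \<in> ball 0 1" if "z \<in> ball 0 1" for z :: complex
      using that radius[of j] mult_le_one[of "radius j" "cmod z"]
      by (auto simp: norm_mult intro: mult_left_le_one_le[THEN order.strict_trans1])
    have "(LINT z|circle. F (of_real (radius j) * z) * cnj z ^ k) =
        (deriv ^^ k) (\<lambda>z. F (of_real (radius j) * z)) 0 / fact k"
      by (rule circle_coefficient[OF hardy_disk_dilation[OF F]])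
    also have "(deriv ^^ k) (\<lambda>z. F (of_real (radius j) * z)) 0 =
        of_real (radius j) ^ k * (deriv ^^ k) F (of_real (radius j) * 0)"
      by (rule higher_deriv_compose_linear[OF hol, where S = "ball 0 1"]) (use in_ball in auto)
    finally show ?thesis by simp
  qed
  moreover have "(\<lambda>j. of_real (radius j) ^ k * ((deriv ^^ k) F 0 / fact k)) \<longlonglongrightarrow>
      of_real 1 ^ k * ((deriv ^^ k) F 0 / fact k)"
    using radius_tendsto unfolding filterlim_at by (intro tendsto_intros) auto
  moreover have "(\<lambda>j. LINT z|circle. F (of_real (radius j) * z) * cnj z ^ k) \<longlonglongrightarrow>
      (LINT z|circle. f z * cnj z ^ k)"
    by (intro hardy_pairing_tendsto[OF F lim f] continuous_circle_bounded continuous_intros)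
  ultimately show ?thesis
    by (simp add: LIMSEQ_unique)
qed

subsection \<open>A spanning set\<close>

lemma L2_of_sum:
  assumes "\<And>i. i \<in> I \<Longrightarrow> g i \<in> disk_algebra"
  shows "L2_of (\<lambda>z. \<Sum>i\<in>I. c i * g i z) = (\<Sum>i\<in>I. c i *\<^sub>C L2_of (g i))"
proof -
  have zero: "L2_of (\<lambda>z. 0) = 0"
    using L2_of_bounded_scaleC[OF circle_bounded_const_id(1), of 0 0] by simp
  from assms show ?thesis
  proof (induction I rule: infinite_finite_induct)
    case (insert i I)
    then have "(\<lambda>z. c i * g i z) \<in> disk_algebra" "(\<lambda>z. \<Sum>i\<in>I. c i * g i z) \<in> disk_algebra"
      by (auto intro!: disk_algebra_intros)
    then have "L2_of (\<lambda>z. c i * g i z + (\<Sum>i\<in>I. c i * g i z)) =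
        L2_of (\<lambda>z. c i * g i z) + L2_of (\<lambda>z. \<Sum>i\<in>I. c i * g i z)"
      by (intro L2_of_bounded_add disk_algebra_circle_bounded)
    also have "L2_of (\<lambda>z. c i * g i z) = c i *\<^sub>C L2_of (g i)"
      using insert by (intro L2_of_bounded_scaleC disk_algebra_circle_bounded) auto
    finally show ?case
      using insert by simp
  qed (simp_all add: zero)
qed

text \<open>The conjugate depends antilinearly on the function.\<close>

lemma subspace_model_pairs:
  assumes "\<alpha> \<in> disk_algebra"
  shows "L2.subspace {L2_of f | f u. model_pair \<alpha> f u}"
proof (rule L2.subspaceI)
  have "L2_of (\<lambda>z. 0) = 0"
    using L2_of_bounded_scaleC[OF circle_bounded_const_id(1), of 0 0] by simp
  moreover have "model_pair \<alpha> (\<lambda>z. 0) (\<lambda>z. 0)"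
    by (simp add: model_pair_def disk_algebra_intros)
  ultimately show "0 \<in> {L2_of f | f u. model_pair \<alpha> f u}" by force
next
  fix F G assume "F \<in> {L2_of f | f u. model_pair \<alpha> f u}" "G \<in> {L2_of f | f u. model_pair \<alpha> f u}"
  then obtain f u g v where *: "F = L2_of f" "model_pair \<alpha> f u" "G = L2_of g" "model_pair \<alpha> g v"
    by blast
  then have "model_pair \<alpha> (\<lambda>z. f z + g z) (\<lambda>z. u z + v z)"
    by (auto simp: model_pair_def algebra_simps intro!: disk_algebra_intros)
  moreover have "F + G = L2_of (\<lambda>z. f z + g z)"
    using * by (simp add: L2_of_bounded_add model_pair_bounded)
  ultimately show "F + G \<in> {L2_of f | f u. model_pair \<alpha> f u}" by blast
next
  fix c F assume "F \<in> {L2_of f | f u. model_pair \<alpha> f u}"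
  then obtain f u where *: "F = L2_of f" "model_pair \<alpha> f u"
    by blast
  then have "model_pair \<alpha> (\<lambda>z. c * f z) (\<lambda>z. cnj c * u z)"
    by (auto simp: model_pair_def algebra_simps intro!: disk_algebra_intros)
  moreover have "c *\<^sub>C F = L2_of (\<lambda>z. c * f z)"
    using * by (simp add: L2_of_bounded_scaleC model_pair_bounded)
  ultimately show "c *\<^sub>C F \<in> {L2_of f | f u. model_pair \<alpha> f u}" by blast
qed

text \<open>With \<open>\<alpha> = c z\<^sup>n (cnj q) / q\<close> on the circle, an element \<open>f\<close> of the model space makes \<open>q f\<close> a
  polynomial of degree less than \<open>n\<close>: its coefficients of index \<open>k \<ge> n\<close> are inner products with
  \<open>\<alpha> z\<^bsup>k-n\<^esup> q\<close>, up to the factor \<open>c\<close>. Hence the model space is spanned by the functions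
  \<open>z\<^sup>i / q\<close> with \<open>i < n\<close>, whose conjugates are \<open>c z\<^bsup>n-1-i\<^esup> / q\<close>.\<close>

lemma
  assumes \<alpha>: "finite_blaschke n \<alpha>"
  shows fin_dim_model_space: "fin_dim (model_space \<alpha>)"
    and model_space_eq_pairs: "model_space \<alpha> = {L2_of f | f u. model_pair \<alpha> f u}"
proof -
  obtain c q where c: "cmod c = 1" and q: "q \<in> disk_algebra"
    and qnz: "\<And>z. z \<in> cball 0 1 \<Longrightarrow> q z \<noteq> 0"
    and \<alpha>d: "\<alpha> \<in> disk_algebra"
    and \<alpha>eq: "\<And>z. z \<in> sphere 0 1 \<Longrightarrow> \<alpha> z = c * z ^ n * cnj (q z) / q z"
    using \<alpha> by (rule finite_blaschke_factorization) blast
  have cc: "c * cnj c = 1"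
    using c by (simp add: complex_norm_square[symmetric])
  define e where "e = (\<lambda>i z. z ^ i / q z)"
  define V where "V = L2.span ((\<lambda>i. L2_of (e i)) ` {..<n})"
  define M where "M = {L2_of f | f u. model_pair \<alpha> f u}"
  have ed: "e i \<in> disk_algebra" for i
    unfolding e_def using q qnz by (intro disk_algebra_intros)
  have pair: "model_pair \<alpha> (e i) (\<lambda>z. c * (z ^ (n - 1 - i) / q z))" if i: "i < n" for i
    unfolding model_pair_def
  proof (intro conjI ballI ed)
    show "(\<lambda>z. c * (z ^ (n - 1 - i) / q z)) \<in> disk_algebra"
      using q qnz by (intro disk_algebra_intros)
    fix z :: complex assume z: "z \<in> sphere 0 1"
    have zz: "z * cnj z = 1" by (rule sphere_mult_cnj[OF z])
    have qz: "q z \<noteq> 0" "cnj (q z) \<noteq> 0" using qnz[of z] z by auto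
    have pw: "z ^ n * (cnj z * cnj z ^ (n - 1 - i)) = z ^ i"
    proof -
      have "n = i + Suc (n - 1 - i)" using i by simp
      then have "z ^ n = z ^ i * z ^ Suc (n - 1 - i)" by (metis power_add)
      then have "z ^ n * (cnj z * cnj z ^ (n - 1 - i)) = z ^ i * (z * cnj z) ^ Suc (n - 1 - i)"
        by (simp add: power_mult_distrib mult_ac)
      then show ?thesis by (simp add: zz)
    qed
    have "\<alpha> z * cnj (z * (c * (z ^ (n - 1 - i) / q z))) =
        (c * cnj c) * (z ^ n * (cnj z * cnj z ^ (n - 1 - i))) / q z"
      unfolding \<alpha>eq[OF z] using qz by (simp add: field_simps)
    then show "e i z = \<alpha> z * cnj (z * (c * (z ^ (n - 1 - i) / q z)))"
      by (simp only: cc pw) (simp add: e_def)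
  qed
  have "(\<lambda>i. L2_of (e i)) ` {..<n} \<subseteq> M"
    unfolding M_def using pair by blast
  then have VM: "V \<subseteq> M"
    unfolding V_def M_def by (intro L2.span_minimal subspace_model_pairs \<alpha>d)
  have MK: "M \<subseteq> model_space \<alpha>"
    unfolding M_def using L2_of_model_pair[OF \<alpha>] by blast
  have KV: "F \<in> V" if F: "F \<in> model_space \<alpha>" for F
  proof -
    obtain f where f: "square_integrable f" "F = L2_of f" by (rule L2_representative)
    have "L2_of f \<in> H2" using F f by (simp add: model_space_def)
    then obtain \<Phi> where \<Phi>: "hardy_disk \<Phi>"
      "AE z in circle. ((\<lambda>r::real. \<Phi> (of_real r * z)) \<longlongrightarrow> f z) (at_left 1)"
      using H2_iff[OF f(1)] by blast
    define \<Psi> where "\<Psi> = (\<lambda>z. q z * \<Phi> z)"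
    have \<Psi>: "hardy_disk \<Psi>"
      unfolding \<Psi>_def by (rule hardy_disk_mult[OF q \<Phi>(1)])
    have \<Psi>_lim: "AE z in circle. ((\<lambda>r::real. \<Psi> (of_real r * z)) \<longlongrightarrow> q z * f z) (at_left 1)"
      using \<Phi>(2) AE_space
    proof eventually_elim
      case (elim z)
      then have "((\<lambda>r::real. q (of_real r * z)) \<longlongrightarrow> q z) (at_left 1)"
        by (intro disk_algebra_radial_limit[OF q]) (simp add: space_circle)
      with elim(1) show ?case
        unfolding \<Psi>_def by (intro tendsto_mult)
    qed
    have qf: "square_integrable (\<lambda>z. q z * f z)"
      by (intro square_integrable_mult_bounded disk_algebra_circle_bounded q f)
    have high: "(deriv ^^ k) \<Psi> 0 / fact k = 0" if k: "k \<ge> n" for k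
    proof -
      have hd: "(\<lambda>z. z ^ (k - n) * q z) \<in> disk_algebra"
        by (intro disk_algebra_intros q)
      then have b: "(\<lambda>z. \<alpha> z * (z ^ (k - n) * q z)) \<in> circle_bounded"
        by (intro disk_algebra_circle_bounded disk_algebra_intros \<alpha>d q)
      have "0 = cinner F (L2_of (\<lambda>z. \<alpha> z * (z ^ (k - n) * q z)))"
        using model_space_orthogonal(1)[OF \<alpha> hd F] by simp
      also have "\<dots> = (LINT z|circle. f z * cnj (\<alpha> z * (z ^ (k - n) * q z)))"
        unfolding f(2) by (intro cinner_L2_of f(1) square_integrable_bounded b)
      also have "\<dots> = (LINT z|circle. cnj c * (q z * f z * cnj z ^ k))"
      proof (rule Bochner_Integration.integral_cong)
        fix z assume "z \<in> space circle"
        then have z: "z \<in> sphere 0 1" by (simp add: space_circle)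
        have "z ^ k = z ^ n * z ^ (k - n)" using k by (simp flip: power_add)
        then have "\<alpha> z * (z ^ (k - n) * q z) = c * z ^ k * cnj (q z)"
          unfolding \<alpha>eq[OF z] using qnz[of z] z by simp
        then show "f z * cnj (\<alpha> z * (z ^ (k - n) * q z)) = cnj c * (q z * f z * cnj z ^ k)"
          by simp
      qed simp
      also have "\<dots> = cnj c * (LINT z|circle. q z * f z * cnj z ^ k)"
        by (rule integral_mult_right_zero)
      also have "(LINT z|circle. q z * f z * cnj z ^ k) = (deriv ^^ k) \<Psi> 0 / fact k"
        by (rule hardy_coefficient[OF \<Psi> \<Psi>_lim qf])
      finally show ?thesis using c by auto
    qed
    define a where "a = (\<lambda>k. (deriv ^^ k) \<Psi> 0 / fact k)"
    have poly: "\<Psi> z = (\<Sum>k<n. a k * z ^ k)" if "z \<in> ball 0 1" for z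
    proof -
      have "(\<lambda>k. a k * (z - 0) ^ k) sums \<Psi> z"
        unfolding a_def using \<Psi> that by (intro holomorphic_power_series) (auto simp: hardy_disk_def)
      moreover have "(\<lambda>k. a k * (z - 0) ^ k) sums (\<Sum>k<n. a k * (z - 0) ^ k)"
        by (rule sums_finite) (use high in \<open>auto simp: a_def\<close>)
      ultimately show ?thesis
        using sums_unique2 by auto
    qed
    define g where "g = (\<lambda>z. \<Sum>k<n. a k * e k z)"
    have gd: "g \<in> disk_algebra"
      unfolding g_def by (intro disk_algebra_intros ed)
    have \<Phi>g: "\<Phi> z = g z" if "z \<in> ball 0 1" for z
    proof -
      have "q z * \<Phi> z = (\<Sum>k<n. a k * z ^ k)"
        using poly[OF that] by (simp add: \<Psi>_def)
      also have "\<dots> = q z * g z"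
        using qnz[of z] that unfolding g_def e_def sum_distrib_left by (intro sum.cong) auto
      finally show ?thesis using qnz[of z] that by simp
    qed
    have "AE z in circle. f z = g z"
      using \<Phi>(2) AE_space
    proof eventually_elim
      case (elim z)
      then have z: "z \<in> sphere 0 1" by (simp add: space_circle)
      have "((\<lambda>r::real. g (of_real r * z)) \<longlongrightarrow> g z) (at_left 1)"
        by (rule disk_algebra_radial_limit[OF gd z])
      moreover have "\<forall>\<^sub>F r in at_left (1::real). g (of_real r * z) = \<Phi> (of_real r * z)"
        using eventually_at_left_real[OF zero_less_one]
        by eventually_elim (use z in \<open>auto simp: \<Phi>g norm_mult\<close>)
      ultimately have "((\<lambda>r::real. \<Phi> (of_real r * z)) \<longlongrightarrow> g z) (at_left 1)"
        by (simp add: tendsto_cong)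
      then show ?case
        using elim(1) by (intro tendsto_unique) auto
    qed
    then have "F = L2_of g"
      unfolding f(2) by (intro L2_of_eqI f square_integrable_bounded disk_algebra_circle_bounded gd)
    also have "\<dots> = (\<Sum>k<n. a k *\<^sub>C L2_of (e k))"
      unfolding g_def by (intro L2_of_sum ed)
    also have "\<dots> \<in> V"
      unfolding V_def by (intro L2.span_sum L2.span_scale L2.span_base) auto
    finally show ?thesis .
  qed
  show "fin_dim (model_space \<alpha>)"
    unfolding fin_dim_def using VM MK KV
    by (intro exI[of _ "(\<lambda>i. L2_of (e i)) ` {..<n}"]) (auto simp: V_def)
  show "model_space \<alpha> = {L2_of f | f u. model_pair \<alpha> f u}"
    unfolding M_def[symmetric] using VM MK KV by blast
qed

lemma model_spaceE:
  assumes "finite_blaschke n \<alpha>" "F \<in> model_space \<alpha>"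
  obtains f u where "F = L2_of f" "model_pair \<alpha> f u"
  using assms model_space_eq_pairs by blast

subsection \<open>The compressed shift\<close>

text \<open>The two kernel functions are conjugates of each other.\<close>

lemma
  assumes \<alpha>: "finite_blaschke n \<alpha>"
  shows k0_in: "k0 \<alpha> \<in> model_space \<alpha>"
    and k0_tilde_in: "k0_tilde \<alpha> \<in> model_space \<alpha>"
proof -
  have \<alpha>d: "\<alpha> \<in> disk_algebra" by (rule finite_blaschke_disk_algebra[OF \<alpha>])
  obtain \<kappa> where \<kappa>: "\<kappa> \<in> disk_algebra" "\<And>z. \<alpha> z = \<alpha> 0 + z * \<kappa> z"
    using disk_algebra_divide_z[OF \<alpha>d] by blast
  let ?k = "\<lambda>z. 1 - cnj (\<alpha> 0) * \<alpha> z"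
  have kd: "?k \<in> disk_algebra" by (intro disk_algebra_intros \<alpha>d)
  have "model_pair \<alpha> ?k \<kappa>"
    unfolding model_pair_def
  proof (intro conjI kd \<kappa>(1) ballI)
    fix z :: complex assume z: "z \<in> sphere 0 1"
    have "z * \<kappa> z = \<alpha> z - \<alpha> 0" using \<kappa>(2)[of z] by simp
    then show "1 - cnj (\<alpha> 0) * \<alpha> z = \<alpha> z * cnj (z * \<kappa> z)"
      using finite_blaschke_unimodular[OF \<alpha> z] by (simp add: right_diff_distrib mult.commute)
  qed
  then show "k0 \<alpha> \<in> model_space \<alpha>"
    unfolding k0_def by (rule L2_of_model_pair[OF \<alpha>])
  have "model_pair \<alpha> \<kappa> ?k"
    unfolding model_pair_def
  proof (intro conjI kd \<kappa>(1) ballI)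
    fix z :: complex assume z: "z \<in> sphere 0 1"
    have "cnj z * (z * \<kappa> z) = cnj z * (\<alpha> z - \<alpha> 0)" using \<kappa>(2)[of z] by simp
    then have "\<kappa> z = cnj z * (\<alpha> z - \<alpha> 0)"
      using sphere_mult_cnj[OF z] by (simp add: mult.assoc[symmetric] mult.commute)
    also have "\<dots> = cnj z * (\<alpha> z - \<alpha> 0 * (\<alpha> z * cnj (\<alpha> z)))"
      using finite_blaschke_unimodular[OF \<alpha> z] by simp
    finally show "\<kappa> z = \<alpha> z * cnj (z * ?k z)"
      by (simp add: algebra_simps)
  qed
  then have "L2_of \<kappa> \<in> model_space \<alpha>"
    by (rule L2_of_model_pair[OF \<alpha>])
  moreover have "k0_tilde \<alpha> = L2_of \<kappa>"
    unfolding k0_tilde_def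
  proof (rule L2_of_cong)
    fix z :: complex assume "z \<in> sphere 0 1"
    then show "(\<alpha> z - \<alpha> 0) / z = \<kappa> z"
      using \<kappa>(2)[of z] by (auto simp: field_simps)
  qed
  ultimately show "k0_tilde \<alpha> \<in> model_space \<alpha>" by simp
qed

text \<open>Multiplication by \<open>z\<close> maps \<open>f = \<alpha> (cnj (z u))\<close> to \<open>\<alpha> (cnj u)\<close>, which fails to lie in the
  model space only through the constant term of \<open>u\<close>.\<close>

lemma compressed_shift_decomposition:
  assumes \<alpha>: "finite_blaschke n \<alpha>" and f: "model_pair \<alpha> f u"
  obtains g v where "model_pair \<alpha> g v" "compressed_shift \<alpha> (L2_of f) = L2_of g"
    "\<And>z. z \<in> sphere 0 1 \<Longrightarrow> z * f z = g z + cinner (L2_of f) (k0_tilde \<alpha>) * \<alpha> z"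
proof -
  have \<alpha>d: "\<alpha> \<in> disk_algebra" by (rule finite_blaschke_disk_algebra[OF \<alpha>])
  have fd: "f \<in> disk_algebra" "u \<in> disk_algebra"
    and rel: "\<And>z. z \<in> sphere 0 1 \<Longrightarrow> f z = \<alpha> z * cnj (z * u z)"
    using f by (auto simp: model_pair_def)
  obtain v where v: "v \<in> disk_algebra" "\<And>z. u z = u 0 + z * v z"
    using disk_algebra_divide_z[OF fd(2)] by blast
  define d where "d = cnj (u 0)"
  define g where "g = (\<lambda>z. z * f z - d * \<alpha> z)"
  have gd: "g \<in> disk_algebra" unfolding g_def by (intro disk_algebra_intros fd \<alpha>d)
  have zf: "z * f z = \<alpha> z * cnj (u z)" if "z \<in> sphere 0 1" for z
  proof -
    have "z * f z = (z * cnj z) * (\<alpha> z * cnj (u z))"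
      by (simp add: rel[OF that] mult_ac)
    then show ?thesis by (simp add: sphere_mult_cnj[OF that])
  qed
  have g: "model_pair \<alpha> g v"
    unfolding model_pair_def
  proof (intro conjI gd v(1) ballI)
    fix z :: complex assume z: "z \<in> sphere 0 1"
    have "z * v z = u z - u 0" using v(2)[of z] by simp
    then show "g z = \<alpha> z * cnj (z * v z)"
      by (simp only: g_def d_def zf[OF z] complex_cnj_diff right_diff_distrib mult.commute)
  qed
  note bounded = disk_algebra_circle_bounded[OF fd(1)] disk_algebra_circle_bounded[OF gd]
    disk_algebra_circle_bounded[OF \<alpha>d]
  have "(\<lambda>z. (\<alpha> z - \<alpha> 0) / z) \<in> circle_bounded"
    by (intro continuous_circle_bounded continuous_intros disk_algebra_continuous_circle \<alpha>d) auto
  then have "cinner (L2_of f) (k0_tilde \<alpha>) = (LINT z|circle. f z * cnj ((\<alpha> z - \<alpha> 0) / z))"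
    unfolding k0_tilde_def by (intro cinner_bounded bounded)
  also have "\<dots> = (LINT z|circle. cnj (u z) - cnj (\<alpha> 0) * (z * f z))"
  proof (rule Bochner_Integration.integral_cong)
    fix z assume "z \<in> space circle"
    then have z: "z \<in> sphere 0 1" by (simp add: space_circle)
    then have inv: "(\<alpha> z - \<alpha> 0) / z = cnj z * (\<alpha> z - \<alpha> 0)"
      using inverse_unique[OF sphere_mult_cnj[OF z]] by (simp add: divide_inverse)
    have "f z * cnj ((\<alpha> z - \<alpha> 0) / z) = z * f z * cnj (\<alpha> z) - cnj (\<alpha> 0) * (z * f z)"
      unfolding inv by (simp add: algebra_simps)
    also have "z * f z * cnj (\<alpha> z) = (\<alpha> z * cnj (\<alpha> z)) * cnj (u z)"
      unfolding zf[OF z] by (simp add: mult_ac)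
    finally show "f z * cnj ((\<alpha> z - \<alpha> 0) / z) = cnj (u z) - cnj (\<alpha> 0) * (z * f z)"
      by (simp add: finite_blaschke_unimodular[OF \<alpha> z])
  qed simp
  also have "\<dots> = (LINT z|circle. cnj (u z)) - (LINT z|circle. cnj (\<alpha> 0) * (z * f z))"
  proof (rule Bochner_Integration.integral_diff)
    show "integrable circle (\<lambda>z. cnj (u z))"
      by (intro integrable_bounded circle_bounded_cnj disk_algebra_circle_bounded fd)
    show "integrable circle (\<lambda>z. cnj (\<alpha> 0) * (z * f z))"
      by (intro integrable_bounded disk_algebra_circle_bounded disk_algebra_intros fd)
  qed
  also have "(LINT z|circle. cnj (\<alpha> 0) * (z * f z)) = 0"
    using circle_mean_shift[OF fd(1)] by (simp only: integral_mult_right_zero mult_zero_right)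
  also have "(LINT z|circle. cnj (u z)) = d"
    unfolding d_def by (simp add: circle_mean[OF fd(2)])
  finally have d: "cinner (L2_of f) (k0_tilde \<alpha>) = d" by simp
  have "compressed_shift \<alpha> (L2_of f) = L2_of g"
    unfolding compressed_shift_def
  proof (rule proj_eqI)
    show "L2.subspace (model_space \<alpha>)"
      by (rule fin_dim_subspace[OF fin_dim_model_space[OF \<alpha>]])
    show "L2_of g \<in> model_space \<alpha>"
      by (rule L2_of_model_pair[OF \<alpha> g])
    fix h assume h: "h \<in> model_space \<alpha>"
    have "L2_of (\<lambda>z. z) \<odot> L2_of f = L2_of (\<lambda>z. g z + \<alpha> z * d)"
      by (simp add: L2_mult_bounded bounded circle_bounded_const_id g_def mult.commute)
    also have "\<dots> = L2_of g + L2_of (\<lambda>z. \<alpha> z * d)"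
      by (intro L2_of_bounded_add bounded circle_bounded_mult circle_bounded_const_id)
    finally show "cinner (L2_of (\<lambda>z. z) \<odot> L2_of f) h = cinner (L2_of g) h"
      using model_space_orthogonal(2)[OF \<alpha> disk_algebra_intros(2) h]
      by (simp add: cinner_add_left)
  qed
  moreover have "z * f z = g z + cinner (L2_of f) (k0_tilde \<alpha>) * \<alpha> z" for z
    by (simp add: d g_def)
  ultimately show thesis using g that by blast
qed

section \<open>Powers of the compressed shift\<close>

lemma clinear_compressed_multiplication:
  assumes \<alpha>: "finite_blaschke n \<alpha>" and g: "g \<in> circle_bounded"
  shows "clinear_on V (model_space \<alpha>) (\<lambda>F. proj (model_space \<alpha>) (L2_of g \<odot> F))"
proof -
  note fd = fin_dim_model_space[OF \<alpha>]
  note sub = fin_dim_subspace[OF fd]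
  let ?T = "\<lambda>F. proj (model_space \<alpha>) (L2_of g \<odot> F)"
  have in_K: "?T F \<in> model_space \<alpha>" for F
    by (rule proj_in[OF fd])
  have T: "\<exists>X. \<forall>F. cinner (?T F) H = cinner F X" if H: "H \<in> model_space \<alpha>" for H
  proof -
    obtain h u where h: "H = L2_of h" "model_pair \<alpha> h u"
      using \<alpha> H by (rule model_spaceE)
    have "cinner (?T F) H = cinner F (L2_of (\<lambda>z. cnj (g z) * h z))" for F
      unfolding cinner_proj[OF fd H] unfolding L2_mult_commute[of "L2_of g"] h(1)
      by (rule cinner_mult_bounded[OF g model_pair_bounded(1)[OF h(2)]])
    then show ?thesis by blast
  qed
  have "?T (F + G) = ?T F + ?T G" for F G
  proof (rule cinner_eqI[OF sub])
    fix H assume "H \<in> model_space \<alpha>"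
    then obtain X where "\<forall>F. cinner (?T F) H = cinner F X" using T by blast
    then show "cinner (?T (F + G)) H = cinner (?T F + ?T G) H" by (simp add: cinner_simps)
  qed (use in_K L2.subspace_add[OF sub] in auto)
  moreover have "?T (c *\<^sub>C F) = c *\<^sub>C ?T F" for c F
  proof (rule cinner_eqI[OF sub])
    fix H assume "H \<in> model_space \<alpha>"
    then obtain X where "\<forall>F. cinner (?T F) H = cinner F X" using T by blast
    then show "cinner (?T (c *\<^sub>C F)) H = cinner (c *\<^sub>C ?T F) H" by (simp add: cinner_simps)
  qed (use in_K L2.subspace_scale[OF sub] in auto)
  ultimately show ?thesis
    using in_K by (simp add: clinear_on_def)
qed

lemma clinear_compressed_shift:
  assumes "finite_blaschke n \<alpha>"
  shows "clinear_on (model_space \<alpha>) (model_space \<alpha>) (compressed_shift \<alpha>)"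
  using clinear_compressed_multiplication[OF assms circle_bounded_const_id(2)]
  by (simp add: clinear_on_def compressed_shift_def)

lemma mod_shift_eq:
  "mod_shift \<alpha> c F = compressed_shift \<alpha> F + (c * cinner F (k0_tilde \<alpha>)) *\<^sub>C k0 \<alpha>"
  by (simp add: mod_shift_def rank_one_def)

lemma clinear_mod_shift:
  assumes \<alpha>: "finite_blaschke n \<alpha>"
  shows "clinear_on (model_space \<alpha>) (model_space \<alpha>) (mod_shift \<alpha> c)"
  using clinear_compressed_shift[OF \<alpha>] k0_in[OF \<alpha>] fin_dim_subspace[OF fin_dim_model_space[OF \<alpha>]]
  by (auto simp: clinear_on_def mod_shift_eq cinner_simps L2.subspace_add L2.subspace_scale algebra_simps)

lemma norm_compressed_shift_le:
  assumes \<alpha>: "finite_blaschke n \<alpha>" and F: "F \<in> model_space \<alpha>"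
  shows "norm (compressed_shift \<alpha> F) \<le> norm F"
proof -
  obtain f u where f: "F = L2_of f" "model_pair \<alpha> f u"
    using \<alpha> F by (rule model_spaceE)
  have fb: "f \<in> circle_bounded" using f(2) by (rule model_pair_bounded)
  have zfb: "(\<lambda>z. z * f z) \<in> circle_bounded"
    by (intro circle_bounded_mult circle_bounded_const_id fb)
  have "cinner (L2_of (\<lambda>z. z * f z)) (L2_of (\<lambda>z. z * f z)) = cinner (L2_of f) (L2_of f)"
    unfolding cinner_bounded[OF zfb zfb] cinner_bounded[OF fb fb]
  proof (rule Bochner_Integration.integral_cong)
    fix z assume "z \<in> space circle"
    then have "z * cnj z = 1" by (simp add: space_circle sphere_mult_cnj)
    moreover have "z * f z * cnj (z * f z) = (z * cnj z) * (f z * cnj (f z))" by simp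
    ultimately show "z * f z * cnj (z * f z) = f z * cnj (f z)" by simp
  qed simp
  then have "norm (L2_of (\<lambda>z. z * f z)) = norm F"
    by (simp add: norm_L2_def f)
  moreover have "compressed_shift \<alpha> F = proj (model_space \<alpha>) (L2_of (\<lambda>z. z * f z))"
    by (simp add: compressed_shift_def f L2_mult_bounded circle_bounded_const_id fb)
  ultimately show ?thesis
    using norm_proj_le[OF fin_dim_model_space[OF \<alpha>], of "L2_of (\<lambda>z. z * f z)"] by simp
qed

text \<open>Powers of the compressed shift are compressions of the powers of \<open>z\<close>, since multiplication by
  \<open>z\<close> preserves \<open>\<alpha> H\<^sup>2\<close>; so they tend weakly to zero.\<close>

lemma compressed_shift_power_weakly_null:
  assumes \<alpha>: "finite_blaschke n \<alpha>" and F: "F \<in> model_space \<alpha>" and G: "G \<in> model_space \<alpha>"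
  shows "(\<lambda>k. cinner G ((compressed_shift \<alpha> ^^ k) F)) \<longlonglongrightarrow> 0"
proof -
  have \<alpha>d: "\<alpha> \<in> disk_algebra" by (rule finite_blaschke_disk_algebra[OF \<alpha>])
  obtain f u where f: "F = L2_of f" "model_pair \<alpha> f u"
    using \<alpha> F by (rule model_spaceE)
  obtain g w where g: "G = L2_of g" "model_pair \<alpha> g w"
    using \<alpha> G by (rule model_spaceE)
  have fb: "f \<in> circle_bounded" and gb: "g \<in> circle_bounded"
    using f g model_pair_bounded by blast+
  have "\<exists>fk uk hk. (compressed_shift \<alpha> ^^ k) F = L2_of fk \<and> model_pair \<alpha> fk uk \<and> hk \<in> disk_algebra \<and>
      (\<forall>z\<in>sphere 0 1. z ^ k * f z = fk z + \<alpha> z * hk z)" for k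
  proof (induction k)
    case 0
    then show ?case
      using f by (intro exI[of _ f] exI[of _ u] exI[of _ "\<lambda>z. 0"]) (simp add: disk_algebra_intros)
  next
    case (Suc k)
    then obtain fk uk hk where k: "(compressed_shift \<alpha> ^^ k) F = L2_of fk" "model_pair \<alpha> fk uk"
      "hk \<in> disk_algebra" "\<forall>z\<in>sphere 0 1. z ^ k * f z = fk z + \<alpha> z * hk z" by blast
    obtain f' u' where f': "model_pair \<alpha> f' u'" "compressed_shift \<alpha> (L2_of fk) = L2_of f'"
      "\<And>z. z \<in> sphere 0 1 \<Longrightarrow> z * fk z = f' z + cinner (L2_of fk) (k0_tilde \<alpha>) * \<alpha> z"
      using compressed_shift_decomposition[OF \<alpha> k(2)] by blast
    define d where "d = cinner (L2_of fk) (k0_tilde \<alpha>)"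
    have "z ^ Suc k * f z = f' z + \<alpha> z * (z * hk z + d)" if "z \<in> sphere 0 1" for z
    proof -
      have "z ^ Suc k * f z = z * (z ^ k * f z)" by simp
      also have "\<dots> = z * fk z + z * (\<alpha> z * hk z)"
        using k(4) that by (simp add: distrib_left)
      finally show ?thesis
        using f'(3)[OF that] by (simp add: d_def algebra_simps)
    qed
    moreover have "(\<lambda>z. z * hk z + d) \<in> disk_algebra"
      by (intro disk_algebra_intros k)
    ultimately show ?case
      using f' k(1) by (intro exI[of _ f'] exI[of _ u'] exI[of _ "\<lambda>z. z * hk z + d"]) simp
  qed
  then have eq: "cinner G ((compressed_shift \<alpha> ^^ k) F) = cinner (L2_of (\<lambda>z. g z * cnj (f z))) (L2_of (\<lambda>z. z ^ k))" for k
  proof -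
    obtain fk uk hk where k: "(compressed_shift \<alpha> ^^ k) F = L2_of fk" "model_pair \<alpha> fk uk"
      "hk \<in> disk_algebra" "\<forall>z\<in>sphere 0 1. z ^ k * f z = fk z + \<alpha> z * hk z"
      using \<open>\<exists>fk uk hk. _ fk uk hk\<close> by blast
    have "L2_of (\<lambda>z. z ^ k * f z) = L2_of (\<lambda>z. fk z + \<alpha> z * hk z)"
      using k(4) by (intro L2_of_cong) auto
    also have "\<dots> = L2_of fk + L2_of (\<lambda>z. \<alpha> z * hk z)"
      using k \<alpha>d by (intro L2_of_bounded_add) (auto simp: model_pair_bounded intro!: disk_algebra_circle_bounded disk_algebra_intros)
    finally have "cinner G (L2_of fk) = cinner G (L2_of (\<lambda>z. z ^ k * f z))"
      using model_space_orthogonal(1)[OF \<alpha> k(3) G] by (simp add: cinner_simps)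
    also have "\<dots> = cinner (L2_of (\<lambda>z. g z * cnj (f z))) (L2_of (\<lambda>z. z ^ k))"
      using fb gb by (simp add: g(1) cinner_bounded circle_bounded_mult circle_bounded_cnj circle_bounded_power mult_ac)
    finally show ?thesis using k(1) by simp
  qed
  show ?thesis
    unfolding eq by (rule cinner_power_tendsto_0)
qed

section \<open>Truncated Toeplitz operators and displacement\<close>

locale model_space_pair =
  fixes \<alpha> \<beta> :: "complex \<Rightarrow> complex" and m n :: nat
  assumes \<alpha>: "finite_blaschke m \<alpha>" and \<beta>: "finite_blaschke n \<beta>"
begin

abbreviation "K \<equiv> model_space \<alpha>"
abbreviation "L \<equiv> model_space \<beta>"

lemmas fin_dim_K = fin_dim_model_space[OF \<alpha>] and fin_dim_L = fin_dim_model_space[OF \<beta>]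
lemmas subspace_K = fin_dim_subspace[OF fin_dim_K] and subspace_L = fin_dim_subspace[OF fin_dim_L]

text \<open>The displacement equation as an identity of sesquilinear forms; \<open>T\<close> on the right slot replaces
  its adjoint on the left one.\<close>

definition rank_two_displacement :: "(L2 \<Rightarrow> L2) \<Rightarrow> (L2 \<Rightarrow> L2) \<Rightarrow> (L2 \<Rightarrow> L2) \<Rightarrow> bool" where
  "rank_two_displacement A S T \<longleftrightarrow>
    (\<exists>chi\<in>K. \<exists>psi\<in>L. \<forall>F\<in>K. \<forall>G\<in>L. cinner (A F) G - cinner (A (S F)) (T G) =
       cinner F (k0_tilde \<alpha>) * cinner psi G + cinner F chi * cinner (k0_tilde \<beta>) G)"

lemma operator_equation_iff:
  assumes A: "clinear_on K L A"
  shows "(\<exists>chi\<in>K. \<exists>psi\<in>L. \<forall>f\<in>K.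
       A f - adjoint_on L (mod_shift \<beta> b) (A (mod_shift \<alpha> a f)) =
       (psi \<otimes> k0_tilde \<alpha>) f + (k0_tilde \<beta> \<otimes> chi) f) \<longleftrightarrow>
    rank_two_displacement A (mod_shift \<alpha> a) (mod_shift \<beta> b)"
proof -
  let ?adj = "adjoint_on L (mod_shift \<beta> b)"
  have AL: "A F \<in> L" if "F \<in> K" for F
    using A that by (simp add: clinear_on_def)
  have SK: "mod_shift \<alpha> a F \<in> K" if "F \<in> K" for F
    using clinear_mod_shift[OF \<alpha>] that by (simp add: clinear_on_def)
  have adj: "?adj X \<in> L" "cinner (?adj X) G = cinner X (mod_shift \<beta> b G)" if "X \<in> L" "G \<in> L" for X G
    using adjoint_on_in[OF fin_dim_L clinear_mod_shift[OF \<beta>] that(1)]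
      cinner_adjoint_on[OF fin_dim_L clinear_mod_shift[OF \<beta>] that]
      cinner_commute[of "?adj X" G] cinner_commute[of X "mod_shift \<beta> b G"] by auto
  have "(A F - ?adj (A (mod_shift \<alpha> a F)) = (psi \<otimes> k0_tilde \<alpha>) F + (k0_tilde \<beta> \<otimes> chi) F) \<longleftrightarrow>
     (\<forall>G\<in>L. cinner (A F) G - cinner (A (mod_shift \<alpha> a F)) (mod_shift \<beta> b G) =
       cinner F (k0_tilde \<alpha>) * cinner psi G + cinner F chi * cinner (k0_tilde \<beta>) G)"
    (is "?X = ?Y \<longleftrightarrow> ?R") if F: "F \<in> K" and "chi \<in> K" "psi \<in> L" for F chi psi
  proof -
    have "?X \<in> L"
      using AL[OF F] adj(1)[OF AL[OF SK[OF F]]] AL[OF F] by (intro L2.subspace_diff[OF subspace_L])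
    moreover have "?Y \<in> L"
      unfolding rank_one_def using that k0_tilde_in[OF \<beta>]
      by (intro L2.subspace_add[OF subspace_L] L2.subspace_scale[OF subspace_L])
    ultimately have "?X = ?Y \<longleftrightarrow> (\<forall>G\<in>L. cinner ?X G = cinner ?Y G)"
      using cinner_eqI[OF subspace_L] by auto
    also have "\<dots> \<longleftrightarrow> ?R"
      using adj(2)[OF AL[OF SK[OF F]]] by (simp add: cinner_simps rank_one_def)
    finally show ?thesis .
  qed
  then show ?thesis
    unfolding rank_two_displacement_def by (intro bex_cong ball_cong refl) auto
qed

text \<open>Adding multiples of \<open>k0 \<otimes> k0_tilde\<close> to the two shifts changes the displacement only by operators
  of the form \<open>psi \<otimes> k0_tilde \<alpha>\<close> and \<open>k0_tilde \<beta> \<otimes> chi\<close>; the new vectors exist by the Riesz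
  representation in finite dimension.\<close>

lemma rank_two_displacement_perturb:
  assumes A: "clinear_on K L A"
    and S: "clinear_on K K S" "\<And>F. F \<in> K \<Longrightarrow> S' F = S F + (a * cinner F (k0_tilde \<alpha>)) *\<^sub>C k0 \<alpha>"
    and T: "clinear_on L L T'" "\<And>G. G \<in> L \<Longrightarrow> T' G = T G + (b * cinner G (k0_tilde \<beta>)) *\<^sub>C k0 \<beta>"
    and rank: "rank_two_displacement A S T"
  shows "rank_two_displacement A S' T'"
proof -
  have A_add: "\<And>F G. \<lbrakk>F \<in> K; G \<in> K\<rbrakk> \<Longrightarrow> A (F + G) = A F + A G"
    and A_scale: "\<And>c F. F \<in> K \<Longrightarrow> A (c *\<^sub>C F) = c *\<^sub>C A F"
    using A by (auto simp: clinear_on_def)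
  have SK: "S F \<in> K" if "F \<in> K" for F using S(1) that by (simp add: clinear_on_def)
  have kK: "k0 \<alpha> \<in> K" by (rule k0_in[OF \<alpha>])
  obtain chi psi where cp: "chi \<in> K" "psi \<in> L"
    and eq: "\<And>F G. \<lbrakk>F \<in> K; G \<in> L\<rbrakk> \<Longrightarrow> cinner (A F) G - cinner (A (S F)) (T G) =
       cinner F (k0_tilde \<alpha>) * cinner psi G + cinner F chi * cinner (k0_tilde \<beta>) G"
    using rank by (auto simp: rank_two_displacement_def)
  obtain chi' where chi': "chi' \<in> K" "\<forall>F\<in>K. cnj b * cinner (A (S F)) (k0 \<beta>) = cinner F chi'"
  proof (rule riesz_representation[OF fin_dim_K, of "\<lambda>F. cnj b * cinner (A (S F)) (k0 \<beta>)"])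
    fix F G assume "F \<in> K" "G \<in> K"
    then show "cnj b * cinner (A (S (F + G))) (k0 \<beta>) =
        cnj b * cinner (A (S F)) (k0 \<beta>) + cnj b * cinner (A (S G)) (k0 \<beta>)"
      using S(1) by (simp add: clinear_on_def A_add cinner_simps distrib_left)
  next
    fix c F assume "F \<in> K"
    then show "cnj b * cinner (A (S (c *\<^sub>C F))) (k0 \<beta>) = c * (cnj b * cinner (A (S F)) (k0 \<beta>))"
      using S(1) by (simp add: clinear_on_def A_scale cinner_simps)
  qed blast
  obtain psi' where psi': "psi' \<in> L" "\<forall>G\<in>L. cnj a * cinner (T' G) (A (k0 \<alpha>)) = cinner G psi'"
  proof (rule riesz_representation[OF fin_dim_L, of "\<lambda>G. cnj a * cinner (T' G) (A (k0 \<alpha>))"])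
    fix F G assume "F \<in> L" "G \<in> L"
    then show "cnj a * cinner (T' (F + G)) (A (k0 \<alpha>)) =
        cnj a * cinner (T' F) (A (k0 \<alpha>)) + cnj a * cinner (T' G) (A (k0 \<alpha>))"
      using T(1) by (simp add: clinear_on_def cinner_simps distrib_left)
  next
    fix c F assume "F \<in> L"
    then show "cnj a * cinner (T' (c *\<^sub>C F)) (A (k0 \<alpha>)) = c * (cnj a * cinner (T' F) (A (k0 \<alpha>)))"
      using T(1) by (simp add: clinear_on_def cinner_simps)
  qed blast
  have "cinner (A F) G - cinner (A (S' F)) (T' G) =
       cinner F (k0_tilde \<alpha>) * cinner (psi - psi') G + cinner F (chi - chi') * cinner (k0_tilde \<beta>) G"
    if FG: "F \<in> K" "G \<in> L" for F G
  proof -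
    have "A (S' F) = A (S F) + (a * cinner F (k0_tilde \<alpha>)) *\<^sub>C A (k0 \<alpha>)"
      using FG(1) SK kK by (simp add: S(2) A_add A_scale L2.subspace_scale[OF subspace_K])
    then have "cinner (A (S' F)) (T' G) =
        cinner (A (S F)) (T' G) + cinner F (k0_tilde \<alpha>) * (a * cinner (A (k0 \<alpha>)) (T' G))"
      by (simp add: cinner_simps)
    also have "a * cinner (A (k0 \<alpha>)) (T' G) = cinner psi' G"
      using psi'(2) FG(2) cinner_commute[of "A (k0 \<alpha>)" "T' G"] cinner_commute[of psi' G]
      by (metis complex_cnj_cnj complex_cnj_mult)
    also have "cinner (A (S F)) (T' G) = cinner (A (S F)) (T G) +
        cnj (cinner G (k0_tilde \<beta>)) * (cnj b * cinner (A (S F)) (k0 \<beta>))"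
      by (simp add: T(2)[OF FG(2)] cinner_simps)
    also have "cnj b * cinner (A (S F)) (k0 \<beta>) = cinner F chi'"
      using chi'(2) FG(1) by blast
    also have "cnj (cinner G (k0_tilde \<beta>)) = cinner (k0_tilde \<beta>) G"
      by (rule cinner_commute[symmetric])
    finally show ?thesis
      using eq[OF FG] by (simp add: cinner_simps algebra_simps)
  qed
  moreover have "chi - chi' \<in> K" "psi - psi' \<in> L"
    using cp chi' psi' L2.subspace_diff[OF subspace_K] L2.subspace_diff[OF subspace_L] by auto
  ultimately show ?thesis
    unfolding rank_two_displacement_def by blast
qed

lemma rank_two_displacement_mod_shift_iff:
  assumes A: "clinear_on K L A"
  shows "rank_two_displacement A (mod_shift \<alpha> a) (mod_shift \<beta> b) \<longleftrightarrow>
    rank_two_displacement A (compressed_shift \<alpha>) (compressed_shift \<beta>)"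
proof
  assume "rank_two_displacement A (mod_shift \<alpha> a) (mod_shift \<beta> b)"
  from rank_two_displacement_perturb[OF A clinear_mod_shift[OF \<alpha>] _ clinear_compressed_shift[OF \<beta>] _ this,
      of "compressed_shift \<alpha>" "- a" "- b"]
  show "rank_two_displacement A (compressed_shift \<alpha>) (compressed_shift \<beta>)"
    by (simp add: mod_shift_eq)
next
  assume "rank_two_displacement A (compressed_shift \<alpha>) (compressed_shift \<beta>)"
  from rank_two_displacement_perturb[OF A clinear_compressed_shift[OF \<alpha>] _ clinear_mod_shift[OF \<beta>] _ this,
      of "mod_shift \<alpha> a" a b b]
  show "rank_two_displacement A (mod_shift \<alpha> a) (mod_shift \<beta> b)"
    by (simp add: mod_shift_eq)
qed

lemma cinner_atto:
  assumes "f \<in> circle_bounded" "g \<in> circle_bounded" "L2_of g \<in> L"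
  shows "cinner (atto \<alpha> \<beta> \<phi> (L2_of f)) (L2_of g) = cinner \<phi> (L2_of (\<lambda>z. cnj (f z) * g z))"
  unfolding atto_def cinner_proj[OF fin_dim_L assms(3)]
  by (rule cinner_mult_bounded[OF assms(1,2)])

text \<open>Both \<open>f\<close> and \<open>g\<close> may be multiplied by \<open>z\<close> in \<open>\<langle>\<phi> f, g\<rangle>\<close> because \<open>z\<close> is unimodular; replacing
  \<open>z f\<close> and \<open>z g\<close> by the shifted functions then costs one multiple of \<open>\<alpha>\<close> and one of \<open>\<beta>\<close>. The
  coefficients of these multiples are \<open>\<langle>f, k0_tilde \<alpha>\<rangle>\<close> and \<open>\<langle>g, k0_tilde \<beta>\<rangle>\<close>, which gives the two
  rank-one terms; the doubly corrected term \<open>\<langle>\<phi> \<alpha>, \<beta>\<rangle>\<close> goes into \<open>psi\<close>.\<close>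

lemma rank_two_displacement_atto:
  "rank_two_displacement (atto \<alpha> \<beta> \<phi>) (compressed_shift \<alpha>) (compressed_shift \<beta>)"
proof -
  have \<alpha>b: "\<alpha> \<in> circle_bounded" and \<beta>b: "\<beta> \<in> circle_bounded"
    using \<alpha> \<beta> by (auto intro!: disk_algebra_circle_bounded elim: finite_blaschke_disk_algebra)
  note bd = \<alpha>b \<beta>b circle_bounded_mult circle_bounded_cnj circle_bounded_const_id circle_bounded_add
  define c where "c = cinner \<phi> (L2_of (\<lambda>z. cnj (\<alpha> z) * \<beta> z))"
  define psi where "psi = proj L (\<phi> \<odot> L2_of (\<lambda>z. \<alpha> z * cnj z)) - c *\<^sub>C k0_tilde \<beta>"
  have psiL: "psi \<in> L"
    unfolding psi_def using k0_tilde_in[OF \<beta>]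
    by (intro L2.subspace_diff[OF subspace_L] L2.subspace_scale[OF subspace_L] proj_in[OF fin_dim_L])
  define X where "X = L2_of (\<lambda>z. cnj z * \<beta> z)"
  have lin: "cinner (\<phi> \<odot> L2_of f) X = cinner \<phi> (L2_of (\<lambda>z. cnj (f z) * (cnj z * \<beta> z)))"
    if "f \<in> circle_bounded" for f
    unfolding X_def using that by (intro cinner_mult_bounded bd)
  obtain chi where chi: "chi \<in> K" "\<forall>F\<in>K. cinner (\<phi> \<odot> F) X = cinner F chi"
  proof (rule riesz_representation[OF fin_dim_K, of "\<lambda>F. cinner (\<phi> \<odot> F) X"])
    fix F G assume FG: "F \<in> K" "G \<in> K"
    obtain f u where f: "F = L2_of f" "model_pair \<alpha> f u" using \<alpha> FG(1) by (rule model_spaceE)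
    obtain g v where g: "G = L2_of g" "model_pair \<alpha> g v" using \<alpha> FG(2) by (rule model_spaceE)
    have b: "f \<in> circle_bounded" "g \<in> circle_bounded" using f g model_pair_bounded by blast+
    have "cinner (\<phi> \<odot> L2_of (\<lambda>z. f z + g z)) X =
        cinner \<phi> (L2_of (\<lambda>z. cnj (f z) * (cnj z * \<beta> z) + cnj (g z) * (cnj z * \<beta> z)))"
      using b by (simp add: lin bd distrib_right)
    also have "\<dots> = cinner (\<phi> \<odot> F) X + cinner (\<phi> \<odot> G) X"
      using b by (simp add: L2_of_bounded_add bd cinner_simps lin f(1) g(1))
    finally show "cinner (\<phi> \<odot> (F + G)) X = cinner (\<phi> \<odot> F) X + cinner (\<phi> \<odot> G) X"
      using b by (simp add: L2_of_bounded_add f(1) g(1))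
  next
    fix d F assume F: "F \<in> K"
    obtain f u where f: "F = L2_of f" "model_pair \<alpha> f u" using \<alpha> F by (rule model_spaceE)
    have b: "f \<in> circle_bounded" using f model_pair_bounded by blast
    have "cinner (\<phi> \<odot> L2_of (\<lambda>z. d * f z)) X =
        cinner \<phi> (L2_of (\<lambda>z. cnj d * (cnj (f z) * (cnj z * \<beta> z))))"
      using b by (simp add: lin bd mult.assoc)
    also have "\<dots> = d * cinner (\<phi> \<odot> F) X"
      using b by (simp add: L2_of_bounded_scaleC bd cinner_simps lin f(1))
    finally show "cinner (\<phi> \<odot> (d *\<^sub>C F)) X = d * cinner (\<phi> \<odot> F) X"
      using b by (simp add: L2_of_bounded_scaleC f(1))
  qed blast
  have "cinner (atto \<alpha> \<beta> \<phi> F) G - cinner (atto \<alpha> \<beta> \<phi> (compressed_shift \<alpha> F)) (compressed_shift \<beta> G) =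
       cinner F (k0_tilde \<alpha>) * cinner psi G + cinner F chi * cinner (k0_tilde \<beta>) G"
    if FG: "F \<in> K" "G \<in> L" for F G
  proof -
    obtain f u where f: "F = L2_of f" "model_pair \<alpha> f u" using \<alpha> FG(1) by (rule model_spaceE)
    obtain g v where g: "G = L2_of g" "model_pair \<beta> g v" using \<beta> FG(2) by (rule model_spaceE)
    define d where "d = cinner F (k0_tilde \<alpha>)"
    define e where "e = cinner G (k0_tilde \<beta>)"
    obtain f1 u1 where f1: "model_pair \<alpha> f1 u1" "compressed_shift \<alpha> F = L2_of f1"
      "\<And>z. z \<in> sphere 0 1 \<Longrightarrow> z * f z = f1 z + d * \<alpha> z"
      using compressed_shift_decomposition[OF \<alpha> f(2)] unfolding f(1)[symmetric] d_def[symmetric] by blast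
    obtain g1 v1 where g1: "model_pair \<beta> g1 v1" "compressed_shift \<beta> G = L2_of g1"
      "\<And>z. z \<in> sphere 0 1 \<Longrightarrow> z * g z = g1 z + e * \<beta> z"
      using compressed_shift_decomposition[OF \<beta> g(2)] unfolding g(1)[symmetric] e_def[symmetric] by blast
    have b: "f \<in> circle_bounded" "g \<in> circle_bounded" "f1 \<in> circle_bounded" "g1 \<in> circle_bounded"
      using f g f1 g1 model_pair_bounded by blast+
    have g1L: "L2_of g1 \<in> L" by (rule L2_of_model_pair[OF \<beta> g1(1)])
    have "L2_of (\<lambda>z. cnj (f z) * g z + (cnj d * e) * (cnj (\<alpha> z) * \<beta> z)) =
      L2_of (\<lambda>z. cnj (f1 z) * g1 z + (cnj d * (cnj (\<alpha> z * cnj z) * g z) + e * (cnj (f z) * (cnj z * \<beta> z))))"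
    proof (rule L2_of_cong)
      fix z :: complex assume z: "z \<in> sphere 0 1"
      have zz: "z * cnj z = 1" by (rule sphere_mult_cnj[OF z])
      have g1z: "g1 z = z * g z - e * \<beta> z" using g1(3)[OF z] by simp
      have "cnj (f1 z) = cnj (z * f z - d * \<alpha> z)" using f1(3)[OF z] by simp
      then have f1z: "cnj (f1 z) = cnj z * cnj (f z) - cnj d * cnj (\<alpha> z)" by simp
      have "cnj (f z) * g z = (z * cnj z) * (cnj (f z) * g z)" using zz by simp
      then show "cnj (f z) * g z + (cnj d * e) * (cnj (\<alpha> z) * \<beta> z) =
        cnj (f1 z) * g1 z + (cnj d * (cnj (\<alpha> z * cnj z) * g z) + e * (cnj (f z) * (cnj z * \<beta> z)))"
        unfolding f1z g1z by (simp add: algebra_simps)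
    qed
    then have "L2_of (\<lambda>z. cnj (f z) * g z) + (cnj d * e) *\<^sub>C L2_of (\<lambda>z. cnj (\<alpha> z) * \<beta> z) =
      L2_of (\<lambda>z. cnj (f1 z) * g1 z) + (cnj d *\<^sub>C L2_of (\<lambda>z. cnj (\<alpha> z * cnj z) * g z)
        + e *\<^sub>C L2_of (\<lambda>z. cnj (f z) * (cnj z * \<beta> z)))"
      using b by (simp only: L2_of_bounded_add L2_of_bounded_scaleC bd)
    from arg_cong[OF this, of "cinner \<phi>"]
    have "cinner \<phi> (L2_of (\<lambda>z. cnj (f z) * g z)) + d * cnj e * c =
      cinner \<phi> (L2_of (\<lambda>z. cnj (f1 z) * g1 z)) + (d * cinner \<phi> (L2_of (\<lambda>z. cnj (\<alpha> z * cnj z) * g z))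
        + cnj e * cinner \<phi> (L2_of (\<lambda>z. cnj (f z) * (cnj z * \<beta> z))))"
      by (simp only: cinner_simps c_def complex_cnj_mult complex_cnj_cnj)
    moreover have "cinner (atto \<alpha> \<beta> \<phi> F) G = cinner \<phi> (L2_of (\<lambda>z. cnj (f z) * g z))"
      unfolding f(1) g(1) using b FG(2) g(1) by (intro cinner_atto) auto
    moreover have "cinner (atto \<alpha> \<beta> \<phi> (compressed_shift \<alpha> F)) (compressed_shift \<beta> G) =
        cinner \<phi> (L2_of (\<lambda>z. cnj (f1 z) * g1 z))"
      unfolding f1(2) g1(2) using b g1L by (intro cinner_atto)
    moreover have "cinner psi G = cinner \<phi> (L2_of (\<lambda>z. cnj (\<alpha> z * cnj z) * g z)) - c * cnj e"
    proof -
      have "cinner (proj L (\<phi> \<odot> L2_of (\<lambda>z. \<alpha> z * cnj z))) G =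
          cinner \<phi> (L2_of (\<lambda>z. cnj (\<alpha> z * cnj z) * g z))"
        unfolding cinner_proj[OF fin_dim_L FG(2)] unfolding g(1) by (intro cinner_mult_bounded bd b)
      then show ?thesis
        unfolding psi_def e_def using cinner_commute[of "k0_tilde \<beta>" G] by (simp add: cinner_simps)
    qed
    moreover have "cinner F chi = cinner \<phi> (L2_of (\<lambda>z. cnj (f z) * (cnj z * \<beta> z)))"
      using chi(2) FG(1) lin[OF b(1)] by (simp add: f(1))
    moreover have "cinner (k0_tilde \<beta>) G = cnj e"
      unfolding e_def by (rule cinner_commute)
    ultimately show ?thesis
      unfolding d_def[symmetric] by algebra
  qed
  with chi(1) psiL show ?thesis
    unfolding rank_two_displacement_def by blast
qed

text \<open>The symbol \<open>z (cnj \<alpha>) psi + (cnj z) \<beta> (cnj chi)\<close> works. Each summand produces one of the two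
  rank-one terms; the other term that it could produce vanishes, for the first summand as an inner
  product of \<open>psi\<close> with an element of \<open>\<beta> H\<^sup>2\<close>, for the second as the mean of an analytic function
  that is zero at 0.\<close>

lemma atto_with_displacement:
  assumes chi: "chi \<in> K" and psi: "psi \<in> L"
  obtains \<phi> where "\<phi> \<in> circle_bounded"
    "\<And>F G. \<lbrakk>F \<in> K; G \<in> L\<rbrakk> \<Longrightarrow> cinner (atto \<alpha> \<beta> (L2_of \<phi>) F) G -
       cinner (atto \<alpha> \<beta> (L2_of \<phi>) (compressed_shift \<alpha> F)) (compressed_shift \<beta> G) =
       cinner F (k0_tilde \<alpha>) * cinner psi G + cinner F chi * cinner (k0_tilde \<beta>) G"
proof -
  have \<alpha>b: "\<alpha> \<in> circle_bounded" and \<beta>b: "\<beta> \<in> circle_bounded"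
    using \<alpha> \<beta> by (auto intro!: disk_algebra_circle_bounded elim: finite_blaschke_disk_algebra)
  note bd = \<alpha>b \<beta>b circle_bounded_mult circle_bounded_cnj circle_bounded_const_id circle_bounded_add
  obtain x x' where x: "chi = L2_of x" "model_pair \<alpha> x x'" using \<alpha> chi by (rule model_spaceE)
  obtain p p' where p: "psi = L2_of p" "model_pair \<beta> p p'" using \<beta> psi by (rule model_spaceE)
  have xb: "x \<in> circle_bounded" and pb: "p \<in> circle_bounded"
    using x p model_pair_bounded by blast+
  define \<phi> where "\<phi> = (\<lambda>z. z * cnj (\<alpha> z) * p z + cnj z * \<beta> z * cnj (x z))"
  have \<phi>b: "\<phi> \<in> circle_bounded"
    unfolding \<phi>_def by (intro bd xb pb)
  have "cinner (atto \<alpha> \<beta> (L2_of \<phi>) F) G -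
       cinner (atto \<alpha> \<beta> (L2_of \<phi>) (compressed_shift \<alpha> F)) (compressed_shift \<beta> G) =
       cinner F (k0_tilde \<alpha>) * cinner psi G + cinner F chi * cinner (k0_tilde \<beta>) G"
    if FG: "F \<in> K" "G \<in> L" for F G
  proof -
    obtain f u where f: "F = L2_of f" "model_pair \<alpha> f u" using \<alpha> FG(1) by (rule model_spaceE)
    obtain g v where g: "G = L2_of g" "model_pair \<beta> g v" using \<beta> FG(2) by (rule model_spaceE)
    define d where "d = cinner F (k0_tilde \<alpha>)"
    define e where "e = cinner G (k0_tilde \<beta>)"
    obtain f1 u1 where f1: "model_pair \<alpha> f1 u1" "compressed_shift \<alpha> F = L2_of f1"
      "\<And>z. z \<in> sphere 0 1 \<Longrightarrow> z * f z = f1 z + d * \<alpha> z"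
      using compressed_shift_decomposition[OF \<alpha> f(2)] unfolding f(1)[symmetric] d_def[symmetric] by blast
    obtain g1 v1 where g1: "model_pair \<beta> g1 v1" "compressed_shift \<beta> G = L2_of g1"
      "\<And>z. z \<in> sphere 0 1 \<Longrightarrow> z * g z = g1 z + e * \<beta> z"
      using compressed_shift_decomposition[OF \<beta> g(2)] unfolding g(1)[symmetric] e_def[symmetric] by blast
    have b: "f \<in> circle_bounded" "g \<in> circle_bounded" "f1 \<in> circle_bounded" "g1 \<in> circle_bounded"
        "u1 \<in> circle_bounded" "v1 \<in> circle_bounded" "x' \<in> circle_bounded"
      using f g f1 g1 x model_pair_bounded by blast+
    have g1L: "L2_of g1 \<in> L" by (rule L2_of_model_pair[OF \<beta> g1(1)])
    have form: "cinner (atto \<alpha> \<beta> (L2_of \<phi>) (L2_of h)) (L2_of k) = (LINT z|circle. \<phi> z * (h z * cnj (k z)))"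
      if "h \<in> circle_bounded" "k \<in> circle_bounded" "L2_of k \<in> L" for h k
      using that by (simp add: cinner_atto cinner_bounded bd \<phi>b)
    have "cinner (atto \<alpha> \<beta> (L2_of \<phi>) F) G -
         cinner (atto \<alpha> \<beta> (L2_of \<phi>) (compressed_shift \<alpha> F)) (compressed_shift \<beta> G) =
        (LINT z|circle. \<phi> z * (f z * cnj (g z))) - (LINT z|circle. \<phi> z * (f1 z * cnj (g1 z)))"
      using form[OF b(1,2)] form[OF b(3,4) g1L] FG(2) by (simp add: f(1)[symmetric] g(1)[symmetric] f1(2) g1(2))
    also have "\<dots> = (LINT z|circle. \<phi> z * (f z * cnj (g z)) - \<phi> z * (f1 z * cnj (g1 z)))"
      by (intro Bochner_Integration.integral_diff[symmetric] integrable_bounded bd \<phi>b b)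
    also have "\<dots> = (LINT z|circle. (d * (p z * cnj (g z)) + cnj e * (p z * cnj (\<beta> z * u1 z))) +
        (cnj e * (f z * cnj (x z)) + d * (z * (v1 z * x' z))))"
    proof (rule Bochner_Integration.integral_cong)
      fix z assume "z \<in> space circle"
      then have z: "z \<in> sphere 0 1" by (simp add: space_circle)
      have zz: "z * cnj z = 1" by (rule sphere_mult_cnj[OF z])
      have aa: "\<alpha> z * cnj (\<alpha> z) = 1" by (rule finite_blaschke_unimodular[OF \<alpha> z])
      have bb: "\<beta> z * cnj (\<beta> z) = 1" by (rule finite_blaschke_unimodular[OF \<beta> z])
      have zf: "f1 z = z * f z - d * \<alpha> z" using f1(3)[OF z] by simp
      have "cnj (g1 z) = cnj (z * g z - e * \<beta> z)" using g1(3)[OF z] by simp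
      then have zg: "cnj (g1 z) = cnj z * cnj (g z) - cnj e * cnj (\<beta> z)" by simp
      have "f1 z = \<alpha> z * cnj (z * u1 z)" using f1(1) z by (simp add: model_pair_def)
      then have f1': "f1 z = \<alpha> z * (cnj z * cnj (u1 z))" by simp
      have "cnj (g1 z) = cnj (\<beta> z * cnj (z * v1 z))" using g1(1) z by (simp add: model_pair_def)
      then have g1': "cnj (g1 z) = cnj (\<beta> z) * (z * v1 z)" by simp
      have "cnj (x z) = cnj (\<alpha> z * cnj (z * x' z))" using x(2) z by (simp add: model_pair_def)
      then have x': "cnj (x z) = cnj (\<alpha> z) * (z * x' z)" by simp
      \<comment> \<open>For the summand of \<open>\<phi>\<close> with \<open>p\<close> the difference is expanded as
        \<open>d \<alpha> (cnj (z g)) + f1 (cnj (e \<beta>))\<close>, for the one with \<open>x\<close> as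
        \<open>d \<alpha> (cnj g1) + z f (cnj (e \<beta>))\<close>.\<close>
      have "\<phi> z * (f z * cnj (g z)) - \<phi> z * (f1 z * cnj (g1 z)) =
          (d * (p z * cnj (g z)) + cnj e * (p z * (cnj (\<beta> z) * cnj (u1 z)))) +
          (cnj e * (f z * cnj (x z)) + d * (z * (v1 z * x' z)))"
        using zz aa bb zf zg f1' g1' x' unfolding \<phi>_def by algebra
      then show "\<phi> z * (f z * cnj (g z)) - \<phi> z * (f1 z * cnj (g1 z)) =
          (d * (p z * cnj (g z)) + cnj e * (p z * cnj (\<beta> z * u1 z))) +
          (cnj e * (f z * cnj (x z)) + d * (z * (v1 z * x' z)))"
        by simp
    qed simp
    also have "\<dots> = (d * (LINT z|circle. p z * cnj (g z)) + cnj e * (LINT z|circle. p z * cnj (\<beta> z * u1 z))) +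
        (cnj e * (LINT z|circle. f z * cnj (x z)) + d * (LINT z|circle. z * (v1 z * x' z)))"
    proof -
      have "integrable circle (\<lambda>z. d * (p z * cnj (g z)))"
        "integrable circle (\<lambda>z. cnj e * (p z * cnj (\<beta> z * u1 z)))"
        "integrable circle (\<lambda>z. cnj e * (f z * cnj (x z)))"
        "integrable circle (\<lambda>z. d * (z * (v1 z * x' z)))"
        by (intro integrable_bounded bd pb xb b)+
      then show ?thesis
        by (simp only: Bochner_Integration.integral_add Bochner_Integration.integrable_add
            integral_mult_right_zero)
    qed
    also have "(LINT z|circle. p z * cnj (g z)) = cinner psi G"
      unfolding p(1) g(1) by (rule cinner_bounded[symmetric]) (intro pb b)+
    also have "(LINT z|circle. p z * cnj (\<beta> z * u1 z)) = cinner psi (L2_of (\<lambda>z. \<beta> z * u1 z))"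
      unfolding p(1) by (rule cinner_bounded[symmetric]) (intro pb b bd)+
    also have "\<dots> = 0"
      using f1(1) by (intro model_space_orthogonal[OF \<beta> _ psi]) (simp add: model_pair_def)
    also have "(LINT z|circle. f z * cnj (x z)) = cinner F chi"
      unfolding f(1) x(1) by (rule cinner_bounded[symmetric]) (intro xb b)+
    also have "(LINT z|circle. z * (v1 z * x' z)) = 0"
      using g1(1) x(2) by (intro circle_mean_shift disk_algebra_intros) (auto simp: model_pair_def)
    also have "cnj e = cinner (k0_tilde \<beta>) G"
      unfolding e_def by (rule cinner_commute[symmetric])
    finally show ?thesis by (simp add: d_def)
  qed
  with \<phi>b that show thesis by blast
qed

text \<open>An operator of displacement zero satisfies \<open>\<langle>D f, g\<rangle> = \<langle>D S\<^sup>k f, T\<^sup>k g\<rangle>\<close> for all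
  \<open>k\<close>, with the two compressed shifts \<open>S\<close> and \<open>T\<close>; the left slot stays bounded while the right
  one tends weakly to zero.\<close>

lemma displacement_zero_imp_zero:
  assumes D: "clinear_on K L D"
    and zero: "\<And>F G. \<lbrakk>F \<in> K; G \<in> L\<rbrakk> \<Longrightarrow>
      cinner (D F) G = cinner (D (compressed_shift \<alpha> F)) (compressed_shift \<beta> G)"
    and F: "F \<in> K"
  shows "D F = 0"
proof -
  let ?S = "compressed_shift \<alpha>" and ?T = "compressed_shift \<beta>"
  have SK: "(?S ^^ k) F \<in> K" for k
    by (induction k) (use F clinear_compressed_shift[OF \<alpha>] in \<open>auto simp: clinear_on_def\<close>)
  have TL: "(?T ^^ k) G \<in> L" if "G \<in> L" for k G
    by (induction k) (use that clinear_compressed_shift[OF \<beta>] in \<open>auto simp: clinear_on_def\<close>)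
  have DL: "D F \<in> L" if "F \<in> K" for F using D that by (simp add: clinear_on_def)
  have norm_S: "norm ((?S ^^ k) F) \<le> norm F" for k
    by (induction k) (use norm_compressed_shift_le[OF \<alpha> SK] order_trans in auto)
  have "cinner (D F) G = cinner 0 G" if G: "G \<in> L" for G
  proof -
    have iter: "cinner (D F) G = cinner (D ((?S ^^ k) F)) ((?T ^^ k) G)" for k
      by (induction k) (use zero[OF SK TL[OF G]] in auto)
    have "(\<lambda>k. cinner (D ((?S ^^ k) F)) ((?T ^^ k) G)) \<longlonglongrightarrow> 0"
    proof (rule tendsto_cinner_weakly_null[OF fin_dim_L])
      show "D ((?S ^^ k) F) \<in> L" for k by (intro DL SK)
      fix w assume w: "w \<in> L"
      show "(\<lambda>k. cinner w ((?T ^^ k) G)) \<longlonglongrightarrow> 0"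
        by (rule compressed_shift_power_weakly_null[OF \<beta> G w])
      obtain y where y: "y \<in> K" "\<forall>F\<in>K. cinner (D F) w = cinner F y"
        by (rule riesz_representation[OF fin_dim_K, of "\<lambda>F. cinner (D F) w"])
           (use D in \<open>auto simp: clinear_on_def cinner_simps\<close>)
      have "cmod (cinner (D ((?S ^^ k) F)) w) \<le> norm F * norm y" for k
      proof -
        have "cmod (cinner (D ((?S ^^ k) F)) w) = cmod (cinner ((?S ^^ k) F) y)"
          using y(2) SK by simp
        also have "\<dots> \<le> norm ((?S ^^ k) F) * norm y" by (rule norm_cinner_le)
        also have "\<dots> \<le> norm F * norm y" using norm_S by (intro mult_right_mono) auto
        finally show ?thesis .
      qed
      then show "\<exists>C. \<forall>k. cmod (cinner (D ((?S ^^ k) F)) w) \<le> C" by blast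
    qed
    then have "cinner (D F) G = 0"
      unfolding iter[symmetric] by (simp add: LIMSEQ_const_iff)
    then show ?thesis by simp
  qed
  then show ?thesis
    using DL[OF F] L2.subspace_0[OF subspace_L] by (intro cinner_eqI[OF subspace_L])
qed

lemma clinear_atto:
  "\<phi> \<in> circle_bounded \<Longrightarrow> clinear_on K L (atto \<alpha> \<beta> (L2_of \<phi>))"
  using clinear_compressed_multiplication[OF \<beta>] by (simp add: clinear_on_def atto_def)

lemma bounded_on_atto:
  assumes "\<phi> \<in> circle_bounded"
  shows "bounded_on K (atto \<alpha> \<beta> (L2_of \<phi>))"
proof -
  obtain B where "\<And>F. norm (L2_of \<phi> \<odot> F) \<le> B * norm F"
    using assms by (rule norm_mult_bounded_le) blast
  then have "norm (atto \<alpha> \<beta> (L2_of \<phi>) F) \<le> B * norm F" for F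
    unfolding atto_def using norm_proj_le[OF fin_dim_L] order_trans by blast
  then show ?thesis by (auto simp: bounded_on_def)
qed

text \<open>Sufficiency of the displacement identity: a truncated Toeplitz operator with the same
  displacement differs from \<open>A\<close> by an operator of displacement zero.\<close>

lemma attos_iff:
  assumes A: "clinear_on K L A"
  shows "A \<in> attos \<alpha> \<beta> \<longleftrightarrow> rank_two_displacement A (compressed_shift \<alpha>) (compressed_shift \<beta>)"
proof
  assume "A \<in> attos \<alpha> \<beta>"
  then obtain \<phi> where eq: "\<And>F. F \<in> K \<Longrightarrow> A F = atto \<alpha> \<beta> \<phi> F"
    by (auto simp: attos_def)
  have "compressed_shift \<alpha> F \<in> K" if "F \<in> K" for F
    using clinear_compressed_shift[OF \<alpha>] that by (simp add: clinear_on_def)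
  then show "rank_two_displacement A (compressed_shift \<alpha>) (compressed_shift \<beta>)"
    using rank_two_displacement_atto[of \<phi>] by (simp add: rank_two_displacement_def eq)
next
  assume "rank_two_displacement A (compressed_shift \<alpha>) (compressed_shift \<beta>)"
  then obtain chi psi where cp: "chi \<in> K" "psi \<in> L"
    and eq: "\<And>F G. \<lbrakk>F \<in> K; G \<in> L\<rbrakk> \<Longrightarrow>
       cinner (A F) G - cinner (A (compressed_shift \<alpha> F)) (compressed_shift \<beta> G) =
       cinner F (k0_tilde \<alpha>) * cinner psi G + cinner F chi * cinner (k0_tilde \<beta>) G"
    unfolding rank_two_displacement_def by blast
  obtain \<phi> where \<phi>: "\<phi> \<in> circle_bounded"
    and eq': "\<And>F G. \<lbrakk>F \<in> K; G \<in> L\<rbrakk> \<Longrightarrow> cinner (atto \<alpha> \<beta> (L2_of \<phi>) F) G -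
       cinner (atto \<alpha> \<beta> (L2_of \<phi>) (compressed_shift \<alpha> F)) (compressed_shift \<beta> G) =
       cinner F (k0_tilde \<alpha>) * cinner psi G + cinner F chi * cinner (k0_tilde \<beta>) G"
    using atto_with_displacement[OF cp] by blast
  define D where "D = (\<lambda>F. A F - atto \<alpha> \<beta> (L2_of \<phi>) F)"
  have D: "clinear_on K L D"
    using A clinear_atto[OF \<phi>] L2.subspace_diff[OF subspace_L]
    by (simp add: clinear_on_def D_def L2.scale_right_diff_distrib)
  have "D F = 0" if "F \<in> K" for F
  proof (rule displacement_zero_imp_zero[OF D _ that])
    fix F G assume "F \<in> K" "G \<in> L"
    then show "cinner (D F) G = cinner (D (compressed_shift \<alpha> F)) (compressed_shift \<beta> G)"
      using eq eq' by (simp add: D_def cinner_diff_left algebra_simps)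
  qed
  then have eqA: "A F = atto \<alpha> \<beta> (L2_of \<phi>) F" if "F \<in> K" for F
    using that by (simp add: D_def)
  moreover have "bounded_on K A"
    using bounded_on_atto[OF \<phi>] eqA by (simp add: bounded_on_def)
  ultimately show "A \<in> attos \<alpha> \<beta>"
    by (auto simp: attos_def)
qed

end

section \<open>The characterization by modified shifts\<close>

theorem corollary3p2:
  fixes \<alpha> \<beta> :: "complex \<Rightarrow> complex" and m n :: nat and a b :: complex and A :: "L2 \<Rightarrow> L2"
  assumes "finite_blaschke m \<alpha>" and "m > 0"
    and "finite_blaschke n \<beta>" and "n > 0"
    and "clinear_on (model_space \<alpha>) (model_space \<beta>) A"
  shows "A \<in> attos \<alpha> \<beta> \<longleftrightarrow>
    (\<exists>chi\<in>model_space \<alpha>. \<exists>psi\<in>model_space \<beta>. \<forall>f\<in>model_space \<alpha>.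
       A f - adjoint_on (model_space \<beta>) (mod_shift \<beta> b) (A (mod_shift \<alpha> a f)) =
       (psi \<otimes> k0_tilde \<alpha>) f + (k0_tilde \<beta> \<otimes> chi) f)"
proof -
  interpret model_space_pair \<alpha> \<beta> m n
    by (rule model_space_pair.intro[OF assms(1,3)])
  show ?thesis
    unfolding attos_iff[OF assms(5)] operator_equation_iff[OF assms(5)]
      rank_two_displacement_mod_shift_iff[OF assms(5)] ..
qed

end
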